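(* Let $\mathcal{I}$ be any one of $\mathcal{P}$, $\mathcal{P}_\infty$, $\mathcal{B}$. The isometry class $\{\mu\in\mathcal{I}: X_\mu$ has the Daugavet property$\}$ is $G_\delta$-complete in $\mathcal{I}$.
   Context: Coding: $V$ is the set of finitely supported rational sequences; $\mathcal{P}\subset\mathbb{R}^V$ the seminorms on $V$ with pointwise convergence topology; for $\mu\in\mathcal{P}$, $\bar\mu$ is its seminorm extension to $c_{00}$ and $X_\mu$ the completion of $c_{00}/\{\bar\mu=0\}$; $\mathcal{P}_\infty=\{\mu:\dim X_\mu=\infty\}$, $\mathcal{B}=\{\mu\in\mathcal{P}_\infty:\bar\mu$ a norm on $c_{00}\}$, subspace topologies. Daugavet property: for every $\varepsilon>0$, $x\in S_X$ and slice $S=\{y\in B_X:f(y)>1-\alpha\}$ ($f\in S_{X^*}$, $\alpha>0$) there is $y\in S$ with $\|x-y\|>2-\varepsilon$. A set $A$ in a Polish space $Z$ is $G_\delta$-complete if it is $G_\delta$ and every $G_\delta$ subset of every zero-dimensional Polish space is a continuous preimage of $A$. *)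

theory Defs
  imports "HOL-Analysis.Analysis"
begin

definition Vset :: "(nat \<Rightarrow> rat) set" where
  "Vset = {q. finite {i. q i \<noteq> 0}}"

definition c00 :: "(nat \<Rightarrow> real) set" where
  "c00 = {x. finite {i. x i \<noteq> 0}}"

definition RV :: "((nat \<Rightarrow> rat) \<Rightarrow> real) topology" where
  "RV = product_topology (\<lambda>_. euclideanreal) Vset"

definition Pset :: "((nat \<Rightarrow> rat) \<Rightarrow> real) set" where
  "Pset = {\<mu> \<in> topspace RV.
      (\<forall>x\<in>Vset. \<forall>y\<in>Vset. \<mu> (\<lambda>i. x i + y i) \<le> \<mu> x + \<mu> y) \<and>
      (\<forall>x\<in>Vset. \<forall>c::rat. \<mu> (\<lambda>i. c * x i) = real_of_rat \<bar>c\<bar> * \<mu> x)}"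

definition qapprox :: "(nat \<Rightarrow> real) \<Rightarrow> nat \<Rightarrow> nat \<Rightarrow> rat" where
  "qapprox x k i = of_int \<lfloor>x i * real (Suc k)\<rfloor> / of_nat (Suc k)"

text \<open>The (unique continuous) seminorm extension of \<mu> from V to c00.\<close>
definition mubar :: "((nat \<Rightarrow> rat) \<Rightarrow> real) \<Rightarrow> (nat \<Rightarrow> real) \<Rightarrow> real" where
  "mubar \<mu> x = lim (\<lambda>k. \<mu> (qapprox x k))"

section \<open>The completion X_mu, modelled by Cauchy sequences in (c00, mubar)\<close>

definition Xpts :: "((nat \<Rightarrow> rat) \<Rightarrow> real) \<Rightarrow> (nat \<Rightarrow> nat \<Rightarrow> real) set" where
  "Xpts \<mu> = {s. (\<forall>n. s n \<in> c00) \<and>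
      (\<forall>e>0. \<exists>N. \<forall>m\<ge>N. \<forall>n\<ge>N. mubar \<mu> (\<lambda>i. s m i - s n i) < e)}"

definition Xnorm :: "((nat \<Rightarrow> rat) \<Rightarrow> real) \<Rightarrow> (nat \<Rightarrow> nat \<Rightarrow> real) \<Rightarrow> real" where
  "Xnorm \<mu> s = lim (\<lambda>n. mubar \<mu> (s n))"

definition Xlin :: "real \<Rightarrow> (nat \<Rightarrow> nat \<Rightarrow> real) \<Rightarrow> real \<Rightarrow> (nat \<Rightarrow> nat \<Rightarrow> real)
    \<Rightarrow> (nat \<Rightarrow> nat \<Rightarrow> real)" where
  "Xlin a s b t = (\<lambda>n i. a * s n i + b * t n i)"

text \<open>Bounded linear functionals on X_mu (they automatically respect the
  identification of sequences at distance 0).\<close>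
definition Xdual :: "((nat \<Rightarrow> rat) \<Rightarrow> real) \<Rightarrow> ((nat \<Rightarrow> nat \<Rightarrow> real) \<Rightarrow> real) set" where
  "Xdual \<mu> = {f. (\<forall>s\<in>Xpts \<mu>. \<forall>t\<in>Xpts \<mu>. \<forall>a b. f (Xlin a s b t) = a * f s + b * f t) \<and>
      (\<exists>K. \<forall>s\<in>Xpts \<mu>. \<bar>f s\<bar> \<le> K * Xnorm \<mu> s)}"

definition Xdual_sphere :: "((nat \<Rightarrow> rat) \<Rightarrow> real) \<Rightarrow> ((nat \<Rightarrow> nat \<Rightarrow> real) \<Rightarrow> real) set" where
  "Xdual_sphere \<mu> = {f \<in> Xdual \<mu>.
      (\<forall>s\<in>Xpts \<mu>. Xnorm \<mu> s \<le> 1 \<longrightarrow> f s \<le> 1) \<and>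
      (\<forall>d>0. \<exists>s\<in>Xpts \<mu>. Xnorm \<mu> s \<le> 1 \<and> f s > 1 - d)}"

definition Daugavet :: "((nat \<Rightarrow> rat) \<Rightarrow> real) \<Rightarrow> bool" where
  "Daugavet \<mu> \<longleftrightarrow>
     (\<forall>e>0. \<forall>x\<in>Xpts \<mu>. Xnorm \<mu> x = 1 \<longrightarrow>
       (\<forall>f\<in>Xdual_sphere \<mu>. \<forall>\<alpha>>0.
          \<exists>y\<in>Xpts \<mu>. Xnorm \<mu> y \<le> 1 \<and> f y > 1 - \<alpha> \<and> Xnorm \<mu> (Xlin 1 x (-1) y) > 2 - e))"

definition Xinfdim :: "((nat \<Rightarrow> rat) \<Rightarrow> real) \<Rightarrow> bool" where
  "Xinfdim \<mu> \<longleftrightarrow> (\<forall>n. \<exists>s. (\<forall>j<n. s j \<in> Xpts \<mu>) \<and>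
      (\<forall>c::nat \<Rightarrow> real. (\<exists>j<n. c j \<noteq> 0) \<longrightarrow>
         Xnorm \<mu> (\<lambda>m i. \<Sum>j<n. c j * s j m i) \<noteq> 0))"

definition Pinf :: "((nat \<Rightarrow> rat) \<Rightarrow> real) set" where
  "Pinf = {\<mu> \<in> Pset. Xinfdim \<mu>}"

definition Bset :: "((nat \<Rightarrow> rat) \<Rightarrow> real) set" where
  "Bset = {\<mu> \<in> Pinf. \<forall>x\<in>c00. mubar \<mu> x = 0 \<longrightarrow> x = (\<lambda>_. 0)}"

definition Polish_top :: "'b topology \<Rightarrow> bool" where
  "Polish_top Y \<longleftrightarrow> completely_metrizable_space Y \<and> separable_space Y"

text \<open>A is G_delta-complete in Z, with the test spaces ranging over
  (zero-dimensional Polish) topologies on the type 'b; the theorem is stated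
  for arbitrary 'b.\<close>
definition Gdelta_complete :: "'b itself \<Rightarrow> 'a topology \<Rightarrow> 'a set \<Rightarrow> bool" where
  "Gdelta_complete (_::'b itself) Z A \<longleftrightarrow> gdelta_in Z A \<and>
     (\<forall>(Y::'b topology) B. Polish_top Y \<and> Y dim_le 0 \<and> gdelta_in Y B \<longrightarrow>
        (\<exists>f. continuous_map Y Z f \<and> B = {y \<in> topspace Y. f y \<in> A}))"

end

theory Submission
  imports Defs
begin

text \<open>
  By Hahn--Banach separation, \<open>X\<^sub>\<mu>\<close> has the Daugavet property iff every \<open>z\<close> in its open unit ball
  lies in the closed convex hull of the points \<open>y\<close> of the ball with \<open>\<parallel>x - y\<parallel>\<close> close to \<open>2\<close>, for every
  \<open>x\<close> of norm slightly above \<open>1\<close>. By density it suffices to test rational vectors, and each test is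
  then an open condition on \<open>\<mu>\<close>; hence the class is a countable intersection of open sets.

  For hardness, the monomials in countably many independent Bernoulli variables span a dense
  subspace of \<open>L\<^sub>1\<close> of a product measure on the Cantor space; they are linearly independent because
  the measure has full support. Its parameters \<open>r\<^sub>j \<in> [1/2, 1)\<close> enter the norms continuously, and the
  space has the Daugavet property iff the measure is atomless, i.e. iff \<open>\<Prod>r\<^sub>j = 0\<close>. Given
  \<open>B = \<Inter>U\<^sub>n\<close> with \<open>U\<^sub>n\<close> open and decreasing, put \<open>r\<^sub>j = exp (-p\<^sub>j)\<close>, where the \<open>p\<^sub>j\<close> are continuous and,
  up to a summable error, consist for every \<open>n\<close> of a series with sum \<open>1/4\<close> on \<open>U\<^sub>n\<close> and \<open>0\<close> off \<open>U\<^sub>n\<close>.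
\<close>

section \<open>Seminorms on rational and real sequences\<close>

text \<open>The obstacle to complexity is the quantifier over functionals: the dual of
  \<open>X\<^sub>\<mu>\<close> changes with \<open>\<mu>\<close>, and a slice is not visible in
  finitely many values of \<open>\<mu>\<close>. Hull membership is: finitely many points and
  rational weights witness it, through strict inequalities between finitely many values of
  \<open>\<mu>\<close>. Functionals survive only inside the proof of equivalence. Vectors of norm
  exactly one are replaced by vectors of norm above or below one, since rational vectors need not
  have rational norm and equality is destroyed by perturbation. On the hardness side, every code
  must be a norm, even where the measure is to have an atom. So no \<open>p\<^sub>j\<close> may
  vanish, and this is what the summable error pays for. The bound 1/2 makes the empty set the
  heaviest point, so only this one candidate for an atom has to be watched. A whole series is spent
  on each \<open>U\<^sub>n\<close>, because a single continuous function positive on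
  \<open>U\<^sub>n\<close> may be arbitrarily small there; the sum of the series is the same at
  every point of \<open>U\<^sub>n\<close>. As the \<open>U\<^sub>n\<close> decrease, a point outside
  the intersection collects only finitely many such sums.\<close>

definition rvec :: "(nat \<Rightarrow> rat) \<Rightarrow> nat \<Rightarrow> real" where
  "rvec v i = real_of_rat (v i)"

definition c00_linear :: "((nat \<Rightarrow> real) \<Rightarrow> real) \<Rightarrow> bool" where
  "c00_linear f \<longleftrightarrow> (\<forall>x\<in>c00. \<forall>y\<in>c00. \<forall>a b. f (\<lambda>i. a * x i + b * y i) = a * f x + b * f y)"

lemma c00_I: "finite F \<Longrightarrow> (\<And>i. i \<notin> F \<Longrightarrow> x i = 0) \<Longrightarrow> x \<in> c00"
  unfolding c00_def by (auto intro: finite_subset)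

lemma c00_lincomb [simp]:
  assumes "x \<in> c00" "y \<in> c00"
  shows "(\<lambda>i. a * x i + b * y i) \<in> c00"
  by (rule c00_I [of "{i. x i \<noteq> 0} \<union> {i. y i \<noteq> 0}"]) (use assms in \<open>auto simp: c00_def\<close>)

lemma c00_add [simp]: "x \<in> c00 \<Longrightarrow> y \<in> c00 \<Longrightarrow> (\<lambda>i. x i + y i) \<in> c00"
  using c00_lincomb [of x y 1 1] by simp

lemma c00_diff [simp]: "x \<in> c00 \<Longrightarrow> y \<in> c00 \<Longrightarrow> (\<lambda>i. x i - y i) \<in> c00"
  using c00_lincomb [of x y 1 "-1"] by simp

lemma c00_scale [simp]: "x \<in> c00 \<Longrightarrow> (\<lambda>i. c * x i) \<in> c00"
  using c00_lincomb [of x x c 0] by simp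

lemma c00_zero [simp]: "(\<lambda>_. 0) \<in> c00"
  by (simp add: c00_def)

lemma c00_sum [simp]: "(\<And>j. j \<in> J \<Longrightarrow> x j \<in> c00) \<Longrightarrow> (\<lambda>i. \<Sum>j\<in>J. x j i) \<in> c00"
  by (induction J rule: infinite_finite_induct) auto

lemma rvec_c00 [simp]: "v \<in> Vset \<Longrightarrow> rvec v \<in> c00"
  by (simp add: Vset_def c00_def rvec_def)

lemma Vset_I: "finite F \<Longrightarrow> (\<And>i. i \<notin> F \<Longrightarrow> v i = 0) \<Longrightarrow> v \<in> Vset"
  unfolding Vset_def by (auto intro: finite_subset)

lemma Vset_add [simp]:
  assumes "v \<in> Vset" "w \<in> Vset"
  shows "(\<lambda>i. v i + w i) \<in> Vset"
  by (rule Vset_I [of "{i. v i \<noteq> 0} \<union> {i. w i \<noteq> 0}"]) (use assms in \<open>auto simp: Vset_def\<close>)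

lemma Vset_diff [simp]:
  assumes "v \<in> Vset" "w \<in> Vset"
  shows "(\<lambda>i. v i - w i) \<in> Vset"
  by (rule Vset_I [of "{i. v i \<noteq> 0} \<union> {i. w i \<noteq> 0}"]) (use assms in \<open>auto simp: Vset_def\<close>)

lemma Vset_scale [simp]: "v \<in> Vset \<Longrightarrow> (\<lambda>i. c * v i) \<in> Vset"
  by (rule Vset_I [of "{i. v i \<noteq> 0}"]) (auto simp: Vset_def)

lemma Vset_zero [simp]: "(\<lambda>_. 0) \<in> Vset"
  by (simp add: Vset_def)

lemma Vset_unit [simp]: "(\<lambda>i. if i = n then c else 0) \<in> Vset"
  by (rule Vset_I [of "{n}"]) auto

lemma countable_Vset: "countable Vset"
proof -
  have "Vset \<subseteq> range (\<lambda>xs i. if i < length xs then xs ! i else 0)"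
  proof
    fix v :: "nat \<Rightarrow> rat" assume "v \<in> Vset"
    then have "finite {i. v i \<noteq> 0}"
      by (simp add: Vset_def)
    then obtain n where "{i. v i \<noteq> 0} \<subseteq> {..<n}"
      using finite_nat_bounded by blast
    then have n: "v i = 0" if "\<not> i < n" for i
      using that by auto
    then have "v = (\<lambda>i. if i < length (map v [0..<n]) then map v [0..<n] ! i else 0)"
      by (simp add: fun_eq_iff)
    then show "v \<in> range (\<lambda>xs i. if i < length xs then xs ! i else 0)"
      by blast
  qed
  then show ?thesis
    by (rule countable_subset) simp
qed

text \<open>Abstract because two seminorms on \<open>c00\<close> occur: the extension
  \<open>mubar \<mu>\<close> and the explicit norm \<open>bnorm r\<close>, which are identified only
  later.\<close>

locale c00_seminorm =
  fixes N :: "(nat \<Rightarrow> real) \<Rightarrow> real"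
  assumes add: "\<And>x y. x \<in> c00 \<Longrightarrow> y \<in> c00 \<Longrightarrow> N (\<lambda>i. x i + y i) \<le> N x + N y"
    and scale: "\<And>x c. x \<in> c00 \<Longrightarrow> N (\<lambda>i. c * x i) = \<bar>c\<bar> * N x"
begin

lemma zero [simp]: "N (\<lambda>_. 0) = 0"
  using scale [of "\<lambda>_. 0" 0] by simp

lemma minus: "x \<in> c00 \<Longrightarrow> N (\<lambda>i. - x i) = N x"
  using scale [of x "-1"] by simp

lemma minus_commute: "x \<in> c00 \<Longrightarrow> y \<in> c00 \<Longrightarrow> N (\<lambda>i. x i - y i) = N (\<lambda>i. y i - x i)"
  using minus [of "\<lambda>i. x i - y i"] by simp

lemma diff_le: "x \<in> c00 \<Longrightarrow> y \<in> c00 \<Longrightarrow> N (\<lambda>i. x i - y i) \<le> N x + N y"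
  using add [of x "\<lambda>i. -1 * y i"] scale [of y "-1"] c00_scale [of y "-1"] by simp

lemma triangle:
  assumes "x \<in> c00" "y \<in> c00" "z \<in> c00"
  shows "N (\<lambda>i. x i - z i) \<le> N (\<lambda>i. x i - y i) + N (\<lambda>i. y i - z i)"
  using add [of "\<lambda>i. x i - y i" "\<lambda>i. y i - z i"] assms by simp

lemma nonneg: "x \<in> c00 \<Longrightarrow> 0 \<le> N x"
  using diff_le [of x x] by simp

lemma le_add_diff: "x \<in> c00 \<Longrightarrow> y \<in> c00 \<Longrightarrow> N x \<le> N y + N (\<lambda>i. x i - y i)"
  using add [of y "\<lambda>i. x i - y i"] by simp

lemma abs_diff_le: "x \<in> c00 \<Longrightarrow> y \<in> c00 \<Longrightarrow> \<bar>N x - N y\<bar> \<le> N (\<lambda>i. x i - y i)"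
  using le_add_diff [of x y] le_add_diff [of y x] minus_commute [of x y] by simp

lemma sum_le: "(\<And>j. j \<in> J \<Longrightarrow> x j \<in> c00) \<Longrightarrow> N (\<lambda>i. \<Sum>j\<in>J. x j i) \<le> (\<Sum>j\<in>J. N (x j))"
proof (induction J rule: infinite_finite_induct)
  case (insert j J)
  have "N (\<lambda>i. \<Sum>j\<in>insert j J. x j i) = N (\<lambda>i. x j i + (\<Sum>j\<in>J. x j i))"
    using insert by simp
  also have "\<dots> \<le> N (x j) + N (\<lambda>i. \<Sum>j\<in>J. x j i)"
    using insert.prems by (intro add) auto
  finally show ?case
    using insert by force
qed auto

text \<open>On sequences supported in the finite set \<open>F\<close>, a seminorm is dominated by
  the absolute coordinates weighted with the seminorms of the unit vectors.\<close>

lemma tendsto_coordinates: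
  assumes F: "finite F" and u: "\<And>k i. i \<notin> F \<Longrightarrow> u k i = 0" and x: "\<And>i. i \<notin> F \<Longrightarrow> x i = 0"
    and lim: "\<And>i. i \<in> F \<Longrightarrow> (\<lambda>k. u k i) \<longlonglongrightarrow> x i"
  shows "(\<lambda>k. N (\<lambda>i. u k i - x i)) \<longlonglongrightarrow> 0" "(\<lambda>k. N (u k)) \<longlonglongrightarrow> N x"
proof -
  have [simp]: "u k \<in> c00" "x \<in> c00" for k
    using F u x by (auto intro: c00_I)
  let ?e = "\<lambda>j i. if i = j then 1 else 0 :: real"
  have e: "?e j \<in> c00" for j
    by (rule c00_I [of "{j}"]) auto
  have bd: "N (\<lambda>i. u k i - x i) \<le> (\<Sum>j\<in>F. \<bar>u k j - x j\<bar> * N (?e j))" for k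
  proof -
    have "(\<lambda>i. u k i - x i) = (\<lambda>i. \<Sum>j\<in>F. (u k j - x j) * ?e j i)"
      using F u x by (auto simp: fun_eq_iff if_distrib [of "\<lambda>c. _ * c"] cong: if_cong)
    moreover have "N (\<lambda>i. \<Sum>j\<in>F. (u k j - x j) * ?e j i) \<le> (\<Sum>j\<in>F. N (\<lambda>i. (u k j - x j) * ?e j i))"
      by (rule sum_le) (rule c00_scale [OF e])
    ultimately show ?thesis
      using scale [OF e] by simp
  qed
  have "(\<lambda>k. \<Sum>j\<in>F. \<bar>u k j - x j\<bar> * N (?e j)) \<longlonglongrightarrow> (\<Sum>j\<in>F. \<bar>x j - x j\<bar> * N (?e j))"
    by (intro tendsto_intros lim)
  then have "(\<lambda>k. \<Sum>j\<in>F. \<bar>u k j - x j\<bar> * N (?e j)) \<longlonglongrightarrow> 0"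
    by simp
  then show *: "(\<lambda>k. N (\<lambda>i. u k i - x i)) \<longlonglongrightarrow> 0"
    by (rule tendsto_sandwich [of "\<lambda>_. 0", rotated 3]) (auto simp: bd nonneg)
  show "(\<lambda>k. N (u k)) \<longlonglongrightarrow> N x"
  proof (rule Lim_transform2 [of "\<lambda>_. N x"])
    show "(\<lambda>k. N x - N (u k)) \<longlonglongrightarrow> 0"
      by (rule tendsto_rabs_zero_cancel, rule tendsto_sandwich [of "\<lambda>_. 0", rotated 3, OF *])
        (auto simp: abs_diff_le minus_commute [of _ x])
  qed simp
qed

end

lemma qapprox_tendsto: "(\<lambda>k. real_of_rat (qapprox x k i)) \<longlonglongrightarrow> x i"
proof -
  have *: "\<bar>real_of_rat (qapprox x k i) - x i\<bar> \<le> 1 / real (Suc k)" for k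
  proof -
    have "real_of_rat (qapprox x k i) = of_int \<lfloor>x i * real (Suc k)\<rfloor> / real (Suc k)"
      by (simp add: qapprox_def of_rat_divide of_rat_add)
    moreover have "\<bar>of_int \<lfloor>x i * real (Suc k)\<rfloor> - x i * real (Suc k)\<bar> \<le> 1"
      by linarith
    moreover have "a / real (Suc k) - x i = (a - x i * real (Suc k)) / real (Suc k)" for a
      by (simp add: field_simps)
    ultimately show ?thesis
      by (simp add: divide_right_mono del: of_nat_Suc)
  qed
  have "(\<lambda>k. 1 / real (Suc k)) \<longlonglongrightarrow> 0"
    by (rule LIMSEQ_Suc, rule lim_1_over_n)
  then have "(\<lambda>k. real_of_rat (qapprox x k i) - x i) \<longlonglongrightarrow> 0"
    by (rule Lim_null_comparison [rotated]) (use * in auto)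
  then show ?thesis
    by (simp add: LIM_zero_iff)
qed

lemma qapprox_eq_0: "x i = 0 \<Longrightarrow> qapprox x k i = 0"
  by (simp add: qapprox_def)

lemma qapprox_Vset [simp]: "x \<in> c00 \<Longrightarrow> qapprox x k \<in> Vset"
  by (rule Vset_I [of "{i. x i \<noteq> 0}"]) (auto simp: c00_def qapprox_eq_0)

section \<open>Seminorms on rational vectors and their extension to \<open>c00\<close>\<close>

context
  fixes \<mu> assumes mu: "\<mu> \<in> Pset"
begin

lemma Pset_add: "v \<in> Vset \<Longrightarrow> w \<in> Vset \<Longrightarrow> \<mu> (\<lambda>i. v i + w i) \<le> \<mu> v + \<mu> w"
  using mu by (simp add: Pset_def)

lemma Pset_scale: "v \<in> Vset \<Longrightarrow> \<mu> (\<lambda>i. c * v i) = real_of_rat \<bar>c\<bar> * \<mu> v"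
  using mu by (simp add: Pset_def)

lemma Pset_zero: "\<mu> (\<lambda>_. 0) = 0"
  using Pset_scale [of "\<lambda>_. 0" 0] by simp

lemma Pset_minus: "v \<in> Vset \<Longrightarrow> \<mu> (\<lambda>i. - v i) = \<mu> v"
  using Pset_scale [of v "-1"] by simp

lemma Pset_le_add_diff: "v \<in> Vset \<Longrightarrow> w \<in> Vset \<Longrightarrow> \<mu> v \<le> \<mu> w + \<mu> (\<lambda>i. v i - w i)"
  using Pset_add [of w "\<lambda>i. v i - w i"] by simp

lemma Pset_abs_diff: "v \<in> Vset \<Longrightarrow> w \<in> Vset \<Longrightarrow> \<bar>\<mu> v - \<mu> w\<bar> \<le> \<mu> (\<lambda>i. v i - w i)"
  using Pset_le_add_diff [of v w] Pset_le_add_diff [of w v] Pset_minus [of "\<lambda>i. v i - w i"] by simp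

lemma Pset_nonneg: "v \<in> Vset \<Longrightarrow> 0 \<le> \<mu> v"
  using Pset_abs_diff [of v v] Pset_add [of v "\<lambda>i. - v i"] Pset_minus [of v] Vset_scale [of v "-1"]
  by (simp add: Pset_zero)

text \<open>The induction peels off one coordinate at a time. The bound makes \<open>\<mu>\<close>
  continuous on rational vectors of common finite support, which is what the extension to real
  vectors rests on.\<close>

lemma Pset_coordinate_bound:
  assumes "finite F" "\<And>i. i \<notin> F \<Longrightarrow> v i = 0"
  shows "\<mu> v \<le> (\<Sum>j\<in>F. \<bar>rvec v j\<bar> * \<mu> (\<lambda>i. if i = j then 1 else 0))"
  using assms
proof (induction F arbitrary: v)
  case empty
  then have "v = (\<lambda>_. 0)" by auto
  then show ?case by (simp add: Pset_zero)
next
  case (insert a F)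
  let ?w = "v(a := 0)"
  have v: "v \<in> Vset" "?w \<in> Vset"
    by (rule Vset_I [of "insert a F"]; use insert in simp)+
  have "\<mu> v = \<mu> (\<lambda>i. ?w i + v a * (if i = a then 1 else 0))"
    by (rule arg_cong [where f = \<mu>]) auto
  also have "\<dots> \<le> \<mu> ?w + \<bar>rvec v a\<bar> * \<mu> (\<lambda>i. if i = a then 1 else 0)"
    using Pset_add [OF v(2) Vset_scale [OF Vset_unit [of a 1], of "v a"]] Pset_scale [OF Vset_unit [of a 1], of "v a"]
    by (simp add: rvec_def)
  also have "\<mu> ?w \<le> (\<Sum>j\<in>F. \<bar>rvec ?w j\<bar> * \<mu> (\<lambda>i. if i = j then 1 else 0))"
    by (rule insert.IH) (use insert.prems in auto)
  also have "\<dots> = (\<Sum>j\<in>F. \<bar>rvec v j\<bar> * \<mu> (\<lambda>i. if i = j then 1 else 0))"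
    using insert.hyps by (intro sum.cong) (auto simp: rvec_def)
  finally show ?case
    using insert.hyps by simp
qed

text \<open>\<open>mubar\<close> is tied to the approximations \<open>qapprox\<close>, and floors do
  not respect sums or multiples. Its algebraic laws therefore need the freedom to use any rational
  approximation within a fixed finite support; by the coordinate bound, two of them have
  asymptotically equal seminorms.\<close>

lemma mubar_limit:
  assumes F: "finite F" and u: "\<And>k i. i \<notin> F \<Longrightarrow> u k i = 0" and x: "\<And>i. i \<notin> F \<Longrightarrow> x i = 0"
    and lim: "\<And>i. i \<in> F \<Longrightarrow> (\<lambda>k. rvec (u k) i) \<longlonglongrightarrow> x i"
  shows "(\<lambda>k. \<mu> (u k)) \<longlonglongrightarrow> mubar \<mu> x"
proof -
  let ?e = "\<lambda>j i. if i = j then 1 else 0 :: rat"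
  have compare: "(\<lambda>k. \<mu> (v k) - \<mu> (w k)) \<longlonglongrightarrow> 0"
    if v: "\<And>k i. i \<notin> F \<Longrightarrow> v k i = 0" and w: "\<And>k i. i \<notin> F \<Longrightarrow> w k i = 0"
      and vw: "\<And>i. i \<in> F \<Longrightarrow> (\<lambda>k. rvec (v k) i - rvec (w k) i) \<longlonglongrightarrow> 0" for v w
  proof (rule Lim_null_comparison [OF always_eventually, rule_format])
    have "(\<lambda>k. \<Sum>j\<in>F. \<bar>rvec (v k) j - rvec (w k) j\<bar> * \<mu> (?e j)) \<longlonglongrightarrow> (\<Sum>j\<in>F. \<bar>0\<bar> * \<mu> (?e j))"
      by (intro tendsto_intros vw)
    then show "(\<lambda>k. \<Sum>j\<in>F. \<bar>rvec (v k) j - rvec (w k) j\<bar> * \<mu> (?e j)) \<longlonglongrightarrow> 0"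
      by simp
    fix k
    have "v k \<in> Vset" "w k \<in> Vset"
      using F v w by (auto intro: Vset_I)
    then have "\<bar>\<mu> (v k) - \<mu> (w k)\<bar> \<le> \<mu> (\<lambda>i. v k i - w k i)"
      by (rule Pset_abs_diff)
    also have "\<dots> \<le> (\<Sum>j\<in>F. \<bar>rvec (\<lambda>i. v k i - w k i) j\<bar> * \<mu> (?e j))"
      by (rule Pset_coordinate_bound) (use F v w in auto)
    finally show "norm (\<mu> (v k) - \<mu> (w k)) \<le> (\<Sum>j\<in>F. \<bar>rvec (v k) j - rvec (w k) j\<bar> * \<mu> (?e j))"
      by (simp add: rvec_def of_rat_diff)
  qed
  have q: "(\<lambda>k. rvec (qapprox x k) i) \<longlonglongrightarrow> x i" for i
    using qapprox_tendsto by (simp add: rvec_def)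
  have "Cauchy (\<lambda>k. \<mu> (qapprox x k))"
  proof (rule CauchyI)
    fix e :: real assume "e > 0"
    have V: "qapprox x k \<in> Vset" for k
      using F x by (intro Vset_I [of F]) (auto simp: qapprox_eq_0)
    have "\<exists>M. \<forall>m\<ge>M. \<forall>n\<ge>M. (\<Sum>j\<in>F. \<bar>rvec (qapprox x m) j - rvec (qapprox x n) j\<bar> * \<mu> (?e j)) < e"
    proof -
      have "(\<lambda>k. \<Sum>j\<in>F. \<bar>rvec (qapprox x k) j - x j\<bar> * \<bar>\<mu> (?e j)\<bar>) \<longlonglongrightarrow> (\<Sum>j\<in>F. \<bar>x j - x j\<bar> * \<bar>\<mu> (?e j)\<bar>)"
        by (intro tendsto_intros q)
      then have "eventually (\<lambda>k. (\<Sum>j\<in>F. \<bar>rvec (qapprox x k) j - x j\<bar> * \<bar>\<mu> (?e j)\<bar>) < e / 2) sequentially"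
        using \<open>e > 0\<close> by (intro order_tendstoD) auto
      then obtain M where M: "\<And>k. k \<ge> M \<Longrightarrow> (\<Sum>j\<in>F. \<bar>rvec (qapprox x k) j - x j\<bar> * \<bar>\<mu> (?e j)\<bar>) < e / 2"
        by (auto simp: eventually_sequentially)
      have "(\<Sum>j\<in>F. \<bar>rvec (qapprox x m) j - rvec (qapprox x n) j\<bar> * \<mu> (?e j)) < e" if "m \<ge> M" "n \<ge> M" for m n
      proof -
        have "(\<Sum>j\<in>F. \<bar>rvec (qapprox x m) j - rvec (qapprox x n) j\<bar> * \<mu> (?e j))
          \<le> (\<Sum>j\<in>F. \<bar>rvec (qapprox x m) j - x j\<bar> * \<bar>\<mu> (?e j)\<bar> + \<bar>rvec (qapprox x n) j - x j\<bar> * \<bar>\<mu> (?e j)\<bar>)"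
          unfolding distrib_right [symmetric] by (intro sum_mono mult_mono) (auto intro: Pset_nonneg)
        also have "\<dots> < e"
          using M [OF that(1)] M [OF that(2)] by (simp add: sum.distrib)
        finally show ?thesis .
      qed
      then show ?thesis by blast
    qed
    then obtain M where M: "\<And>m n. m \<ge> M \<Longrightarrow> n \<ge> M \<Longrightarrow>
        (\<Sum>j\<in>F. \<bar>rvec (qapprox x m) j - rvec (qapprox x n) j\<bar> * \<mu> (?e j)) < e"
      by blast
    have "norm (\<mu> (qapprox x m) - \<mu> (qapprox x n)) < e" if "m \<ge> M" "n \<ge> M" for m n
    proof -
      have "\<bar>\<mu> (qapprox x m) - \<mu> (qapprox x n)\<bar> \<le> \<mu> (\<lambda>i. qapprox x m i - qapprox x n i)"
        using V V by (rule Pset_abs_diff)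
      also have "\<dots> \<le> (\<Sum>j\<in>F. \<bar>rvec (\<lambda>i. qapprox x m i - qapprox x n i) j\<bar> * \<mu> (?e j))"
        by (rule Pset_coordinate_bound) (use F x in \<open>auto simp: qapprox_eq_0\<close>)
      also have "\<dots> < e"
        using M [OF that] by (simp add: rvec_def of_rat_diff)
      finally show ?thesis by simp
    qed
    then show "\<exists>M. \<forall>m\<ge>M. \<forall>n\<ge>M. norm (\<mu> (qapprox x m) - \<mu> (qapprox x n)) < e"
      by blast
  qed
  then have lim1: "(\<lambda>k. \<mu> (qapprox x k)) \<longlonglongrightarrow> mubar \<mu> x"
    unfolding mubar_def using Cauchy_convergent_iff convergent_LIMSEQ_iff by blast
  have "(\<lambda>k. \<mu> (u k) - \<mu> (qapprox x k)) \<longlonglongrightarrow> 0"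
  proof (rule compare)
    show "(\<lambda>k. rvec (u k) i - rvec (qapprox x k) i) \<longlonglongrightarrow> 0" if "i \<in> F" for i
      using tendsto_diff [OF lim [OF that] q [of i]] by simp
  qed (use u x in \<open>auto simp: qapprox_eq_0\<close>)
  from tendsto_add [OF this lim1] show ?thesis
    by simp
qed

lemma mubar_qapprox: "x \<in> c00 \<Longrightarrow> (\<lambda>k. \<mu> (qapprox x k)) \<longlonglongrightarrow> mubar \<mu> x"
  by (rule mubar_limit [of "{i. x i \<noteq> 0}"])
    (auto simp: c00_def qapprox_eq_0 rvec_def qapprox_tendsto)

lemma mubar_rvec: "v \<in> Vset \<Longrightarrow> mubar \<mu> (rvec v) = \<mu> v"
  by (rule LIMSEQ_unique [OF mubar_limit [of "{i. v i \<noteq> 0}" "\<lambda>_. v" "rvec v"]])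
    (simp_all add: Vset_def rvec_def)

lemma mubar_seminorm: "c00_seminorm (mubar \<mu>)"
proof
  fix x y :: "nat \<Rightarrow> real" assume xy: "x \<in> c00" "y \<in> c00"
  have "(\<lambda>k. \<mu> (\<lambda>i. qapprox x k i + qapprox y k i)) \<longlonglongrightarrow> mubar \<mu> (\<lambda>i. x i + y i)"
    by (rule mubar_limit [of "{i. x i \<noteq> 0} \<union> {i. y i \<noteq> 0}"])
      (use xy in \<open>auto simp: c00_def qapprox_eq_0 rvec_def of_rat_add intro: tendsto_add qapprox_tendsto\<close>)
  then show "mubar \<mu> (\<lambda>i. x i + y i) \<le> mubar \<mu> x + mubar \<mu> y"
    by (rule LIMSEQ_le [OF _ tendsto_add [OF mubar_qapprox [OF xy(1)] mubar_qapprox [OF xy(2)]]])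
      (use xy Pset_add in auto)
next
  fix x :: "nat \<Rightarrow> real" and c :: real assume x: "x \<in> c00"
  \<comment> \<open>Rational approximations of the scalar, read off at coordinate 0 of a constant
    sequence: \<open>\<mu>\<close> is homogeneous for rational factors only.\<close>
  let ?c = "\<lambda>k. qapprox (\<lambda>_. c) k 0"
  have c: "(\<lambda>k. real_of_rat (?c k)) \<longlonglongrightarrow> c"
    by (rule qapprox_tendsto)
  have "(\<lambda>k. \<mu> (\<lambda>i. ?c k * qapprox x k i)) \<longlonglongrightarrow> mubar \<mu> (\<lambda>i. c * x i)"
    by (rule mubar_limit [of "{i. x i \<noteq> 0}"])
      (use x in \<open>auto simp: c00_def qapprox_eq_0 rvec_def of_rat_mult intro: tendsto_mult c qapprox_tendsto\<close>)
  moreover have "(\<lambda>k. \<mu> (\<lambda>i. ?c k * qapprox x k i)) \<longlonglongrightarrow> \<bar>c\<bar> * mubar \<mu> x"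
  proof -
    have "\<mu> (\<lambda>i. ?c k * qapprox x k i) = \<bar>real_of_rat (?c k)\<bar> * \<mu> (qapprox x k)" for k
      using Pset_scale [OF qapprox_Vset [OF x]] by simp
    then show ?thesis
      using tendsto_mult [OF tendsto_rabs [OF c] mubar_qapprox [OF x]] by simp
  qed
  ultimately show "mubar \<mu> (\<lambda>i. c * x i) = \<bar>c\<bar> * mubar \<mu> x"
    by (rule LIMSEQ_unique)
qed

lemma Vset_dense:
  assumes x: "x \<in> c00" and "\<delta> > 0"
  obtains v where "v \<in> Vset" "mubar \<mu> (\<lambda>i. x i - rvec v i) < \<delta>"
proof -
  interpret c00_seminorm "mubar \<mu>" by (rule mubar_seminorm)
  have "(\<lambda>k. mubar \<mu> (\<lambda>i. rvec (qapprox x k) i - x i)) \<longlonglongrightarrow> 0"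
    by (rule tendsto_coordinates [of "{i. x i \<noteq> 0}"])
      (use x in \<open>auto simp: c00_def qapprox_eq_0 rvec_def qapprox_tendsto\<close>)
  then have "eventually (\<lambda>k. mubar \<mu> (\<lambda>i. rvec (qapprox x k) i - x i) < \<delta>) sequentially"
    using \<open>\<delta> > 0\<close> by (rule order_tendstoD)
  then obtain k where "mubar \<mu> (\<lambda>i. rvec (qapprox x k) i - x i) < \<delta>"
    using eventually_happens'[OF sequentially_bot] by blast
  then show ?thesis
    using that [of "qapprox x k"] minus_commute [of x "rvec (qapprox x k)"] x by simp
qed

end

section \<open>The Daugavet property tested on finitely supported sequences\<close>

lemma c00_linearD:
  assumes "c00_linear f" "x \<in> c00" "y \<in> c00"
  shows "f (\<lambda>i. a * x i + b * y i) = a * f x + b * f y"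
    and "f (\<lambda>i. x i + y i) = f x + f y"
    and "f (\<lambda>i. x i - y i) = f x - f y"
    and "f (\<lambda>i. c * x i) = c * f x"
proof -
  have *: "f (\<lambda>i. a * x i + b * y i) = a * f x + b * f y" for a b
    using assms by (simp add: c00_linear_def)
  from * show "f (\<lambda>i. a * x i + b * y i) = a * f x + b * f y" .
  from * [of 1 1] * [of 1 "-1"] * [of c 0] show "f (\<lambda>i. x i + y i) = f x + f y"
    "f (\<lambda>i. x i - y i) = f x - f y" "f (\<lambda>i. c * x i) = c * f x" by simp_all
qed

lemma c00_linear_zero: "c00_linear f \<Longrightarrow> f (\<lambda>_. 0) = 0"
  using c00_linearD(4) [of f "\<lambda>_. 0" "\<lambda>_. 0" 0] by simp

lemma c00_linear_sum:
  assumes "c00_linear f" "\<And>j. j \<in> J \<Longrightarrow> x j \<in> c00"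
  shows "f (\<lambda>i. \<Sum>j\<in>J. c j * x j i) = (\<Sum>j\<in>J. c j * f (x j))"
  using assms(2)
proof (induction J rule: infinite_finite_induct)
  case (insert j J)
  then show ?case
    using c00_linearD(1) [OF assms(1), of "x j" "\<lambda>i. \<Sum>j\<in>J. c j * x j i" "c j" 1] by simp
qed (use c00_linear_zero [OF assms(1)] in auto)

lemma c00_linear_sup_pos:
  assumes f: "c00_linear f" and v: "v \<in> c00" and "f v \<noteq> 0"
  obtains u where "u \<in> c00" "f u > 0"
proof (cases "f v > 0")
  case False
  then have "f (\<lambda>i. -1 * v i) > 0"
    using c00_linearD(4) [OF f v v, of "-1"] \<open>f v \<noteq> 0\<close> by simp
  with c00_scale [OF v] show ?thesis using that by blast
qed (use that v in blast)

section \<open>Cauchy sequences as points of the completion, and reduction to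
  \<open>c00\<close>\<close>

context
  fixes \<mu> assumes mu: "\<mu> \<in> Pset"
begin

interpretation c00_seminorm "mubar \<mu>"
  using mu by (rule mubar_seminorm)

lemma Xpts_const [simp]: "x \<in> c00 \<Longrightarrow> (\<lambda>_. x) \<in> Xpts \<mu>"
  by (simp add: Xpts_def)

lemma Xnorm_const [simp]: "Xnorm \<mu> (\<lambda>_. x) = mubar \<mu> x"
  by (simp add: Xnorm_def)

lemma Xpts_c00 [simp]: "s \<in> Xpts \<mu> \<Longrightarrow> s n \<in> c00"
  by (simp add: Xpts_def)

lemma Xpts_Cauchy:
  assumes "s \<in> Xpts \<mu>" "e > 0"
  obtains M where "\<And>m n. m \<ge> M \<Longrightarrow> n \<ge> M \<Longrightarrow> mubar \<mu> (\<lambda>i. s m i - s n i) < e"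
  using assms unfolding Xpts_def by blast

text \<open>Serves both the seminorm itself and the functionals dominated by it.\<close>

lemma Lipschitz_Xpts_convergent:
  assumes s: "s \<in> Xpts \<mu>"
    and g: "\<And>x y. x \<in> c00 \<Longrightarrow> y \<in> c00 \<Longrightarrow> \<bar>g x - g y\<bar> \<le> mubar \<mu> (\<lambda>i. x i - y i)"
  shows "(\<lambda>n. g (s n)) \<longlonglongrightarrow> (lim (\<lambda>n. g (s n)) :: real)"
proof -
  have "Cauchy (\<lambda>n. g (s n))"
  proof (rule CauchyI)
    fix e :: real assume "e > 0"
    obtain M where M: "\<And>m n. m \<ge> M \<Longrightarrow> n \<ge> M \<Longrightarrow> mubar \<mu> (\<lambda>i. s m i - s n i) < e"
      using Xpts_Cauchy [OF s \<open>e > 0\<close>] by blast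
    have "norm (g (s m) - g (s n)) < e" if "m \<ge> M" "n \<ge> M" for m n
      using M [OF that] g [of "s m" "s n"] s by simp
    then show "\<exists>M. \<forall>m\<ge>M. \<forall>n\<ge>M. norm (g (s m) - g (s n)) < e"
      by blast
  qed
  then show ?thesis
    using Cauchy_convergent_iff convergent_LIMSEQ_iff by blast
qed

lemma Xnorm_limit: "s \<in> Xpts \<mu> \<Longrightarrow> (\<lambda>n. mubar \<mu> (s n)) \<longlonglongrightarrow> Xnorm \<mu> s"
  unfolding Xnorm_def by (rule Lipschitz_Xpts_convergent) (auto intro: abs_diff_le)

lemma Xlin_Xpts [simp]:
  assumes s: "s \<in> Xpts \<mu>" and t: "t \<in> Xpts \<mu>"
  shows "Xlin a s b t \<in> Xpts \<mu>"
  unfolding Xpts_def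
proof (intro CollectI conjI allI impI)
  show "Xlin a s b t n \<in> c00" for n
    using s t by (simp add: Xlin_def)
  fix e :: real assume "e > 0"
  \<comment> \<open>The summand 1 keeps the divisor positive when both scalars vanish and makes the
    final estimate strict.\<close>
  let ?c = "\<bar>a\<bar> + \<bar>b\<bar> + 1"
  have "e / ?c > 0" using \<open>e > 0\<close> by simp
  obtain M1 where M1: "\<And>m n. m \<ge> M1 \<Longrightarrow> n \<ge> M1 \<Longrightarrow> mubar \<mu> (\<lambda>i. s m i - s n i) < e / ?c"
    using Xpts_Cauchy [OF s \<open>e / ?c > 0\<close>] by blast
  obtain M2 where M2: "\<And>m n. m \<ge> M2 \<Longrightarrow> n \<ge> M2 \<Longrightarrow> mubar \<mu> (\<lambda>i. t m i - t n i) < e / ?c"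
    using Xpts_Cauchy [OF t \<open>e / ?c > 0\<close>] by blast
  have "mubar \<mu> (\<lambda>i. Xlin a s b t m i - Xlin a s b t n i) < e" if "m \<ge> max M1 M2" "n \<ge> max M1 M2" for m n
  proof -
    have c: "(\<lambda>i. s m i - s n i) \<in> c00" "(\<lambda>i. t m i - t n i) \<in> c00"
      using s t by simp_all
    have "(\<lambda>i. Xlin a s b t m i - Xlin a s b t n i)
        = (\<lambda>i. a * (s m i - s n i) + b * (t m i - t n i))"
      by (simp add: Xlin_def algebra_simps)
    then have "mubar \<mu> (\<lambda>i. Xlin a s b t m i - Xlin a s b t n i)
        \<le> \<bar>a\<bar> * mubar \<mu> (\<lambda>i. s m i - s n i) + \<bar>b\<bar> * mubar \<mu> (\<lambda>i. t m i - t n i)"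
      using add [OF c00_scale [OF c(1)] c00_scale [OF c(2)], of a b] scale [OF c(1)] scale [OF c(2)]
      by simp
    also have "\<dots> \<le> \<bar>a\<bar> * (e / ?c) + \<bar>b\<bar> * (e / ?c)"
      using M1 [of m n] M2 [of m n] that by (intro add_mono mult_left_mono) auto
    also have "\<dots> = (\<bar>a\<bar> + \<bar>b\<bar>) * (e / ?c)"
      by (simp only: distrib_right)
    also have "\<dots> < ?c * (e / ?c)"
      using \<open>e / ?c > 0\<close> by (intro mult_strict_right_mono) auto
    also have "\<dots> = e" by simp
    finally show ?thesis .
  qed
  then show "\<exists>M. \<forall>m\<ge>M. \<forall>n\<ge>M. mubar \<mu> (\<lambda>i. Xlin a s b t m i - Xlin a s b t n i) < e"
    by blast
qed

text \<open>Density of \<open>c00\<close> in the completion: a point is the limit of the constant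
  sequences formed by its own terms.\<close>

lemma Xnorm_diff_terms:
  assumes s: "s \<in> Xpts \<mu>"
  shows "(\<lambda>n. Xnorm \<mu> (Xlin 1 s (-1) (\<lambda>_. s n))) \<longlonglongrightarrow> 0"
proof (rule LIMSEQ_I)
  fix e :: real assume "e > 0"
  obtain M where M: "\<And>m n. m \<ge> M \<Longrightarrow> n \<ge> M \<Longrightarrow> mubar \<mu> (\<lambda>i. s m i - s n i) < e / 2"
    using Xpts_Cauchy [OF s, of "e / 2"] \<open>e > 0\<close> by auto
  have "norm (Xnorm \<mu> (Xlin 1 s (-1) (\<lambda>_. s n)) - 0) < e" if "n \<ge> M" for n
  proof -
    have lim: "(\<lambda>m. mubar \<mu> (\<lambda>i. s m i - s n i)) \<longlonglongrightarrow> Xnorm \<mu> (Xlin 1 s (-1) (\<lambda>_. s n))"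
      using Xnorm_limit [OF Xlin_Xpts [OF s Xpts_const [OF Xpts_c00 [OF s, of n]]], of 1 "-1"]
      by (simp add: Xlin_def)
    have "Xnorm \<mu> (Xlin 1 s (-1) (\<lambda>_. s n)) \<le> e / 2"
      by (rule LIMSEQ_le_const2 [OF lim]) (use M that in \<open>auto intro!: exI [of _ M] less_imp_le\<close>)
    moreover have "0 \<le> Xnorm \<mu> (Xlin 1 s (-1) (\<lambda>_. s n))"
      by (rule LIMSEQ_le_const [OF lim]) (use s in \<open>auto intro!: nonneg\<close>)
    ultimately show ?thesis using \<open>e > 0\<close> by simp
  qed
  then show "\<exists>M. \<forall>n\<ge>M. norm (Xnorm \<mu> (Xlin 1 s (-1) (\<lambda>_. s n)) - 0) < e"
    by blast
qed

text \<open>Slices are traded for comparison with a point \<open>z\<close>: inside the unit ball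
  \<open>f z\<close> cannot exceed the dual norm of \<open>f\<close>, so every point of a thin slice
  of the normalised functional has \<open>f y > f z - e\<close>. A nonzero value of \<open>f\<close>
  is what permits the normalisation.\<close>

lemma Daugavet_on_c00:
  assumes D: "Daugavet \<mu>" and f: "c00_linear f" and fle: "\<And>v. v \<in> c00 \<Longrightarrow> f v \<le> mubar \<mu> v"
    and nz: "v0 \<in> c00" "f v0 \<noteq> 0"
    and x: "x \<in> c00" "mubar \<mu> x > 1" and z: "z \<in> c00" "mubar \<mu> z < 1" and "e > 0"
  obtains y where "y \<in> c00" "mubar \<mu> y < 1" "f y > f z - e" "mubar \<mu> (\<lambda>i. x i - y i) > 2 - e"
proof -
  note lin = c00_linearD [OF f]
  have zero_ball: "(\<lambda>_. 0) \<in> {v\<in>c00. mubar \<mu> v \<le> 1}"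
    by simp
  \<comment> \<open>The dual norm of \<open>f\<close>. Domination by the seminorm gives
    \<open>K \<le> 1\<close>, and \<open>f v0 \<noteq> 0\<close> gives \<open>K > 0\<close>.\<close>
  define K where "K = (SUP v\<in>{v\<in>c00. mubar \<mu> v \<le> 1}. f v)"
  have bdd: "bdd_above (f ` {v\<in>c00. mubar \<mu> v \<le> 1})"
    using fle by (force intro: bdd_aboveI2 [of _ _ 1])
  have fK: "f v \<le> K" if "v \<in> c00" "mubar \<mu> v \<le> 1" for v
    unfolding K_def using that bdd by (intro cSUP_upper) auto
  have "K \<le> 1"
    unfolding K_def
  proof (rule cSUP_least)
    show "f v \<le> 1" if "v \<in> {v\<in>c00. mubar \<mu> v \<le> 1}" for v
      using fle [of v] that by simp
  qed (use zero_ball in blast)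
  obtain u where u: "u \<in> c00" "f u > 0"
    using c00_linear_sup_pos [OF f nz] by blast
  have Nu: "mubar \<mu> u > 0"
    using fle [OF u(1)] u by linarith
  have "f (\<lambda>i. inverse (mubar \<mu> u) * u i) \<le> K"
    using u Nu by (intro fK) (simp_all add: scale)
  moreover have "f (\<lambda>i. inverse (mubar \<mu> u) * u i) > 0"
    unfolding lin(4) [OF u(1) u(1)] using u Nu by simp
  ultimately have "K > 0" by linarith
  have fKN: "f v \<le> K * mubar \<mu> v" if v: "v \<in> c00" for v
  proof (cases "mubar \<mu> v = 0")
    case True
    then show ?thesis using fle [OF v] by simp
  next
    case False
    then have pos: "mubar \<mu> v > 0" using nonneg [OF v] by simp
    have "f (\<lambda>i. inverse (mubar \<mu> v) * v i) \<le> K"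
      using v pos by (intro fK) (simp_all add: scale)
    then show ?thesis
      unfolding lin(4) [OF v v] using pos by (simp add: field_simps)
  qed
  have fabs: "\<bar>f v\<bar> \<le> mubar \<mu> v" if v: "v \<in> c00" for v
    using fle [OF v] fle [OF c00_scale [OF v, of "-1"]] lin(4) [OF v v, of "-1"] minus [OF v] by simp
  \<comment> \<open>Limits along Cauchy sequences extend \<open>f\<close> to the completion;
    division by \<open>K\<close> puts the extension on the dual sphere.\<close>
  define F where "F s = lim (\<lambda>n. f (s n)) / K" for s :: "nat \<Rightarrow> nat \<Rightarrow> real"
  have flim: "(\<lambda>n. f (s n)) \<longlonglongrightarrow> K * F s" if "s \<in> Xpts \<mu>" for s
    using Lipschitz_Xpts_convergent [OF that, of f] \<open>K > 0\<close>
    by (simp add: F_def lin(3) [symmetric] fabs)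
  have Fle: "F s \<le> Xnorm \<mu> s" if s: "s \<in> Xpts \<mu>" for s
  proof -
    have "K * F s \<le> K * Xnorm \<mu> s"
      by (rule LIMSEQ_le [OF flim [OF s] tendsto_mult_left [OF Xnorm_limit [OF s]]])
        (use s fKN in auto)
    then show ?thesis using \<open>K > 0\<close> by simp
  qed
  have Flin: "F (Xlin a s b t) = a * F s + b * F t" if "s \<in> Xpts \<mu>" "t \<in> Xpts \<mu>" for s t a b
  proof -
    have "(\<lambda>n. f (Xlin a s b t n)) \<longlonglongrightarrow> a * (K * F s) + b * (K * F t)"
      using tendsto_add [OF tendsto_mult_left [OF flim [OF that(1)], of a] tendsto_mult_left [OF flim [OF that(2)], of b]]
        that by (simp add: Xlin_def lin(1))
    then have "K * F (Xlin a s b t) = a * (K * F s) + b * (K * F t)"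
      using flim [OF Xlin_Xpts [OF that]] LIMSEQ_unique by blast
    then have "K * F (Xlin a s b t) = K * (a * F s + b * F t)"
      by (simp add: algebra_simps)
    then show ?thesis using \<open>K > 0\<close> by simp
  qed
  have Fconst: "F (\<lambda>_. v) = f v / K" if "v \<in> c00" for v
    by (simp add: F_def)
  have "F \<in> Xdual \<mu>"
    unfolding Xdual_def
  proof (intro CollectI conjI exI [of _ 1] ballI allI)
    fix s assume s: "s \<in> Xpts \<mu>"
    have "Xlin (-1) s 0 s = (\<lambda>n i. - s n i)" by (simp add: Xlin_def)
    then have "Xnorm \<mu> (Xlin (-1) s 0 s) = Xnorm \<mu> s"
      using s by (simp add: Xnorm_def minus)
    moreover have "- F s \<le> Xnorm \<mu> (Xlin (-1) s 0 s)"
      using Fle [OF Xlin_Xpts [OF s s], of "-1" 0] Flin [OF s s, of "-1" 0] by simp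
    ultimately show "\<bar>F s\<bar> \<le> 1 * Xnorm \<mu> s" using Fle [OF s] by simp
  qed (use Flin in auto)
  moreover have "\<exists>s\<in>Xpts \<mu>. Xnorm \<mu> s \<le> 1 \<and> F s > 1 - d" if "d > 0" for d
  proof -
    have "K - K * d < K" using that \<open>K > 0\<close> by simp
    then obtain v where v: "v \<in> c00" "mubar \<mu> v \<le> 1" "K - K * d < f v"
      unfolding K_def using less_cSUP_iff [OF _ bdd] zero_ball by blast
    then have "F (\<lambda>_. v) > 1 - d"
      using \<open>K > 0\<close> by (simp add: Fconst field_simps)
    with v show ?thesis by (intro bexI [of _ "\<lambda>_. v"]) auto
  qed
  ultimately have FS: "F \<in> Xdual_sphere \<mu>"
    using Fle by (force simp: Xdual_sphere_def)
  let ?c = "mubar \<mu> x"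
  define x' where "x' = (\<lambda>i. inverse ?c * x i)"
  have x': "x' \<in> c00" "mubar \<mu> x' = 1"
    using x by (simp_all add: x'_def scale)
  \<comment> \<open>The estimate for \<open>x'\<close> is multiplied by \<open>?c\<close> at the
    end; this choice keeps that loss at \<open>?c * (2 * \<delta>) = e / 2\<close>.\<close>
  define \<delta> where "\<delta> = e / (4 * ?c)"
  have \<delta>: "\<delta> > 0" "?c * \<delta> = e / 4" "\<delta> \<le> e / 4"
    using x \<open>e > 0\<close> by (auto simp: \<delta>_def field_simps)
  obtain s where s: "s \<in> Xpts \<mu>" "Xnorm \<mu> s \<le> 1" "F s > 1 - e / 4"
    "Xnorm \<mu> (Xlin 1 (\<lambda>_. x') (-1) s) > 2 - \<delta>"
    using D x' FS \<open>e > 0\<close> \<delta>(1) unfolding Daugavet_def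
    by (metis Xnorm_const Xpts_const divide_pos_pos zero_less_numeral)
  have "f z \<le> K" using z by (intro fK) auto
  have "K * F s > K * (1 - e / 4)"
    using s \<open>K > 0\<close> by simp
  moreover have "K * (e / 4) \<le> e / 4"
    using \<open>K \<le> 1\<close> \<open>e > 0\<close> by (simp add: mult_left_le_one_le \<open>K > 0\<close> less_imp_le)
  ultimately have "K * F s > f z - e / 4"
    using \<open>f z \<le> K\<close> by (simp add: right_diff_distrib)
  then have ev1: "eventually (\<lambda>n. f (s n) > f z - e / 4) sequentially"
    using flim [OF s(1)] by (simp add: order_tendsto_iff)
  have ev2: "eventually (\<lambda>n. mubar \<mu> (s n) < 1 + \<delta>) sequentially"
    using Xnorm_limit [OF s(1)] s(2) \<delta>(1) by (intro order_tendstoD) auto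
  have "(\<lambda>n. mubar \<mu> (\<lambda>i. x' i - s n i)) \<longlonglongrightarrow> Xnorm \<mu> (Xlin 1 (\<lambda>_. x') (-1) s)"
    using Xnorm_limit [OF Xlin_Xpts [OF Xpts_const [OF x'(1)] s(1)], of 1 "-1"] by (simp add: Xlin_def)
  then have ev3: "eventually (\<lambda>n. mubar \<mu> (\<lambda>i. x' i - s n i) > 2 - \<delta>) sequentially"
    using s(4) by (intro order_tendstoD) auto
  obtain n where n: "f (s n) > f z - e / 4" "mubar \<mu> (s n) < 1 + \<delta>" "mubar \<mu> (\<lambda>i. x' i - s n i) > 2 - \<delta>"
    using eventually_happens' [OF sequentially_bot eventually_conj [OF ev1 eventually_conj [OF ev2 ev3]]] by blast
  \<comment> \<open>The term may slightly exceed norm 1; shrinking it by \<open>1 + \<delta>\<close>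
    puts it into the open ball and moves it by at most \<open>\<delta>\<close>.\<close>
  define y where "y = (\<lambda>i. inverse (1 + \<delta>) * s n i)"
  have sn: "s n \<in> c00" using s(1) by simp
  then have y: "y \<in> c00" by (simp add: y_def)
  have Ny: "mubar \<mu> y < 1"
    unfolding y_def scale [OF sn] using n(2) \<delta>(1) by (simp add: field_simps)
  have "(\<lambda>i. s n i - y i) = (\<lambda>i. (\<delta> / (1 + \<delta>)) * s n i)"
    using \<delta>(1) by (auto simp: y_def field_simps)
  then have "mubar \<mu> (\<lambda>i. s n i - y i) = (\<delta> / (1 + \<delta>)) * mubar \<mu> (s n)"
    using \<delta>(1) scale [OF sn, of "\<delta> / (1 + \<delta>)"] by simp
  also have "\<dots> \<le> (\<delta> / (1 + \<delta>)) * (1 + \<delta>)"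
    using n(2) \<delta>(1) by (intro mult_left_mono) auto
  finally have close: "mubar \<mu> (\<lambda>i. s n i - y i) \<le> \<delta>"
    using \<delta>(1) by simp
  have "f y > f z - e"
    using n(1) close \<delta>(3) \<open>e > 0\<close> fle [OF c00_diff [OF sn y]] lin(3) [OF sn y] by linarith
  moreover have "mubar \<mu> (\<lambda>i. x i - y i) > 2 - e"
  proof -
    have 1: "mubar \<mu> (\<lambda>i. x' i - y i) > 2 - 2 * \<delta>"
      using triangle [OF x'(1) y sn] minus_commute [OF y sn] close n(3) by linarith
    \<comment> \<open>Undoes the normalisation of \<open>x\<close>. Since \<open>y\<close> has norm
      below 1, the norm of \<open>x - y\<close> is at least
      \<open>?c * (2 - 2 * \<delta>) - (?c - 1) = ?c + 1 - e / 2\<close>, which beats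
      \<open>2 - e\<close> because \<open>?c > 1\<close>.\<close>
    have "(\<lambda>i. ?c * (x' i - y i)) = (\<lambda>i. (x i - y i) - (?c - 1) * y i)"
      using x by (auto simp: x'_def field_simps)
    then have "?c * mubar \<mu> (\<lambda>i. x' i - y i) = mubar \<mu> (\<lambda>i. (x i - y i) - (?c - 1) * y i)"
      using scale [OF c00_diff [OF x'(1) y], of ?c] x by simp
    also have "\<dots> \<le> mubar \<mu> (\<lambda>i. x i - y i) + (?c - 1) * mubar \<mu> y"
      using diff_le [OF c00_diff [OF x(1) y] c00_scale [OF y, of "?c - 1"]] scale [OF y, of "?c - 1"] x
      by simp
    also have "(?c - 1) * mubar \<mu> y \<le> ?c - 1"
      using Ny x nonneg [OF y] by (simp add: mult_left_le)
    finally have "?c * mubar \<mu> (\<lambda>i. x' i - y i) \<le> mubar \<mu> (\<lambda>i. x i - y i) + (?c - 1)" by simp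
    moreover have "?c * mubar \<mu> (\<lambda>i. x' i - y i) \<ge> ?c * (2 - 2 * \<delta>)"
      using 1 x by (intro mult_left_mono) auto
    ultimately have "mubar \<mu> (\<lambda>i. x i - y i) \<ge> ?c * (2 - 2 * \<delta>) - (?c - 1)"
      by linarith
    also have "?c * (2 - 2 * \<delta>) = 2 * ?c - e / 2"
      using \<delta>(2) by (simp add: algebra_simps)
    finally show ?thesis using x \<open>e > 0\<close> by linarith
  qed
  ultimately show ?thesis using that y Ny by blast
qed

text \<open>The premise \<open>mubar \<mu> z > 1 - e\<close> comes for free, as \<open>z\<close> is
  taken where \<open>f\<close> nearly attains its norm 1. It lightens the task of verifying
  \<open>H\<close>: \<open>Daugavet_bcode\<close> produces points \<open>y\<close> with the norm of
  \<open>z\<close> and needs this norm close to 1.\<close>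

lemma Daugavet_if_on_c00:
  assumes H: "\<And>f x z e. \<lbrakk>c00_linear f; \<And>v. v \<in> c00 \<Longrightarrow> f v \<le> mubar \<mu> v; x \<in> c00; mubar \<mu> x > 1;
      z \<in> c00; mubar \<mu> z < 1; mubar \<mu> z > 1 - e; e > 0\<rbrakk>
      \<Longrightarrow> \<exists>y\<in>c00. mubar \<mu> y < 1 \<and> f y > f z - e \<and> mubar \<mu> (\<lambda>i. x i - y i) > 2 - e"
  shows "Daugavet \<mu>"
  unfolding Daugavet_def
proof (intro allI impI ballI)
  fix e \<alpha> :: real and x F
  assume "e > 0" and x: "x \<in> Xpts \<mu>" "Xnorm \<mu> x = 1" and FS: "F \<in> Xdual_sphere \<mu>" and "\<alpha> > 0"
  from FS have FD: "F \<in> Xdual \<mu>" by (simp add: Xdual_sphere_def)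
  then obtain K where K: "\<And>s. s \<in> Xpts \<mu> \<Longrightarrow> \<bar>F s\<bar> \<le> K * Xnorm \<mu> s"
    unfolding Xdual_def by blast
  have Flin: "F (Xlin a s b t) = a * F s + b * F t" if "s \<in> Xpts \<mu>" "t \<in> Xpts \<mu>" for s t a b
    using FD that by (simp add: Xdual_def)
  define f where "f v = F (\<lambda>_. v)" for v
  have f: "c00_linear f"
    unfolding c00_linear_def
  proof (intro ballI allI)
    fix x y :: "nat \<Rightarrow> real" and a b :: real assume "x \<in> c00" "y \<in> c00"
    then show "f (\<lambda>i. a * x i + b * y i) = a * f x + b * f y"
      using Flin [of "\<lambda>_. x" "\<lambda>_. y" a b] by (simp add: f_def Xlin_def)
  qed
  note lin = c00_linearD [OF f]
  have fle: "f v \<le> mubar \<mu> v" if v: "v \<in> c00" for v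
  proof (cases "mubar \<mu> v = 0")
    case True
    then show ?thesis using K [of "\<lambda>_. v"] v by (simp add: f_def)
  next
    case False
    then have pos: "mubar \<mu> v > 0" using nonneg [OF v] by simp
    let ?w = "\<lambda>i. inverse (mubar \<mu> v) * v i"
    have w: "?w \<in> c00" "mubar \<mu> ?w = 1"
      using v pos by (simp_all add: scale)
    then have "f ?w \<le> 1"
      using FS Xpts_const [OF w(1)] Xnorm_const [of ?w] by (auto simp: Xdual_sphere_def f_def)
    then show ?thesis
      unfolding lin(4) [OF v v] using pos by (simp add: field_simps)
  qed
  \<comment> \<open>The losses below add up to \<open>5 * \<eta>\<close> in the distance and
    \<open>4 * \<eta>\<close> in the value of the functional, so an eighth is enough.\<close>
  define \<eta> where "\<eta> = min (min e \<alpha>) 1 / 8"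
  have \<eta>: "\<eta> > 0" "8 * \<eta> \<le> e" "8 * \<eta> \<le> \<alpha>" "\<eta> < 1"
    using \<open>e > 0\<close> \<open>\<alpha> > 0\<close> by (auto simp: \<eta>_def)
  obtain s where s: "s \<in> Xpts \<mu>" "Xnorm \<mu> s \<le> 1" "F s > 1 - \<eta>"
    using FS \<eta>(1) by (auto simp: Xdual_sphere_def)
  have "(\<lambda>n. F s - f (s n)) \<longlonglongrightarrow> 0"
  proof (rule Lim_null_comparison [OF always_eventually, rule_format])
    show "(\<lambda>n. K * Xnorm \<mu> (Xlin 1 s (-1) (\<lambda>_. s n))) \<longlonglongrightarrow> 0"
      using tendsto_mult_left [OF Xnorm_diff_terms [OF s(1)], of K] by simp
    show "norm (F s - f (s n)) \<le> K * Xnorm \<mu> (Xlin 1 s (-1) (\<lambda>_. s n))" for n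
      using K [OF Xlin_Xpts [OF s(1) Xpts_const [OF Xpts_c00 [OF s(1), of n]]], of 1 "-1"] s(1)
      by (simp add: f_def Flin)
  qed
  then have "(\<lambda>n. f (s n)) \<longlonglongrightarrow> F s"
    using tendsto_diff [OF tendsto_const [of "F s"]] by fastforce
  then have ev1: "eventually (\<lambda>n. f (s n) > 1 - \<eta>) sequentially"
    using s(3) by (rule order_tendstoD)
  have ev2: "eventually (\<lambda>n. mubar \<mu> (s n) < 1 + \<eta>) sequentially"
    using Xnorm_limit [OF s(1)] s(2) \<eta>(1) by (intro order_tendstoD) auto
  obtain n where n: "f (s n) > 1 - \<eta>" "mubar \<mu> (s n) < 1 + \<eta>"
    using eventually_happens' [OF sequentially_bot eventually_conj [OF ev1 ev2]] by blast
  define z where "z = (\<lambda>i. inverse (1 + \<eta>) * s n i)"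
  have sn: "s n \<in> c00" using s(1) by simp
  have z: "z \<in> c00" "mubar \<mu> z < 1" "f z > 1 - 2 * \<eta>"
  proof -
    show "z \<in> c00" using sn by (simp add: z_def)
    show "mubar \<mu> z < 1"
      unfolding z_def scale [OF sn] using n(2) \<eta>(1) by (simp add: field_simps)
    have "f z = f (s n) / (1 + \<eta>)"
      unfolding z_def lin(4) [OF sn sn] by (simp add: field_simps)
    moreover have "(1 - 2 * \<eta>) * (1 + \<eta>) < f (s n)"
      using n(1) \<eta>(1) by (simp add: algebra_simps) (smt (verit) mult_pos_pos)
    ultimately show "f z > 1 - 2 * \<eta>"
      using \<eta>(1) by (simp add: pos_less_divide_eq)
  qed
  obtain M1 where M1: "\<And>m n. m \<ge> M1 \<Longrightarrow> n \<ge> M1 \<Longrightarrow> mubar \<mu> (\<lambda>i. x m i - x n i) < \<eta>"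
    using Xpts_Cauchy [OF x(1) \<eta>(1)] by blast
  have "eventually (\<lambda>n. mubar \<mu> (x n) > 1 / (1 + \<eta>)) sequentially"
    using Xnorm_limit [OF x(1)] x(2) \<eta>(1) by (intro order_tendstoD) auto
  moreover have "eventually (\<lambda>n. mubar \<mu> (x n) < 2) sequentially"
    using Xnorm_limit [OF x(1)] x(2) by (intro order_tendstoD) auto
  ultimately have "eventually (\<lambda>n. mubar \<mu> (x n) > 1 / (1 + \<eta>) \<and> mubar \<mu> (x n) < 2 \<and> n \<ge> M1) sequentially"
    using eventually_ge_at_top [of M1] by eventually_elim auto
  then obtain M where M: "mubar \<mu> (x M) > 1 / (1 + \<eta>)" "mubar \<mu> (x M) < 2" "M \<ge> M1"
    using eventually_happens' [OF sequentially_bot] by blast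
  have xM: "x m \<in> c00" for m using x(1) by simp
  \<comment> \<open>Enlarging the term by \<open>1 + \<eta>\<close> lifts its norm above 1, as
    \<open>H\<close> requires, and moves it by less than \<open>2 * \<eta>\<close> because its norm
    is below 2.\<close>
  define x0 where "x0 = (\<lambda>i. (1 + \<eta>) * x M i)"
  have x0: "x0 \<in> c00"
    using xM [of M] by (simp add: x0_def)
  have "mubar \<mu> x0 > 1"
    unfolding x0_def scale [OF xM [of M]] using M(1) \<eta>(1) by (simp add: field_simps)
  note x0 = x0 this
  have "(\<lambda>i. x0 i - x M i) = (\<lambda>i. \<eta> * x M i)"
    by (auto simp: x0_def algebra_simps)
  then have x0M: "mubar \<mu> (\<lambda>i. x0 i - x M i) < 2 * \<eta>"
    using M(2) \<eta>(1) xM [of M] by (simp add: scale)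
  \<comment> \<open>Tolerance \<open>2 * \<eta>\<close> matches \<open>f z > 1 - 2 * \<eta>\<close>:
    domination then yields the lower bound on the norm of \<open>z\<close>.\<close>
  obtain y where y: "y \<in> c00" "mubar \<mu> y < 1" "f y > f z - 2 * \<eta>" "mubar \<mu> (\<lambda>i. x0 i - y i) > 2 - 2 * \<eta>"
    using H [OF f fle x0 z(1,2), of "2 * \<eta>"] z(3) fle [OF z(1)] \<eta>(1) by fastforce
  have ylim: "(\<lambda>m. mubar \<mu> (\<lambda>i. x m i - y i)) \<longlonglongrightarrow> Xnorm \<mu> (Xlin 1 x (-1) (\<lambda>_. y))"
    using Xnorm_limit [OF Xlin_Xpts [OF x(1) Xpts_const [OF y(1)]], of 1 "-1"] by (simp add: Xlin_def)
  have "2 - 5 * \<eta> \<le> Xnorm \<mu> (Xlin 1 x (-1) (\<lambda>_. y))"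
  proof (rule LIMSEQ_le_const [OF ylim], intro exI allI impI)
    fix m assume "m \<ge> M"
    then show "2 - 5 * \<eta> \<le> mubar \<mu> (\<lambda>i. x m i - y i)"
      using triangle [OF x0(1) xM [of M] y(1)] triangle [OF xM [of M] xM [of m] y(1)] M1 [of M m]
        M(3) x0M y(4) by simp
  qed
  then show "\<exists>y\<in>Xpts \<mu>. Xnorm \<mu> y \<le> 1 \<and> F y > 1 - \<alpha> \<and> Xnorm \<mu> (Xlin 1 x (-1) y) > 2 - e"
    using y z(3) \<eta> by (intro bexI [of _ "\<lambda>_. y"]) (auto simp: f_def)
qed

end

section \<open>The class is a countable intersection of open sets\<close>

lemma rvec_diff: "rvec (\<lambda>i. v i - w i) = (\<lambda>i. rvec v i - rvec w i)"
  by (auto simp: rvec_def of_rat_diff)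

text \<open>Hahn--Banach for the countable-dimensional space of rational sequences, in the form of a
  functional lying below a convex cone: its coefficients are chosen one after the other.\<close>

lemma cone_functional_step:
  fixes R :: "(nat \<Rightarrow> rat) \<Rightarrow> real \<Rightarrow> bool"
  assumes R_add: "\<And>v w r s. R v r \<Longrightarrow> R w s \<Longrightarrow> R (\<lambda>i. v i + w i) (r + s)"
    and R_scale: "\<And>v r c. R v r \<Longrightarrow> c > 0 \<Longrightarrow> R (\<lambda>i. c * v i) (real_of_rat c * r)"
    and R_unit: "\<exists>r. R (\<lambda>i. if i = n then 1 else 0) r" "\<exists>r. R (\<lambda>i. if i = n then -1 else 0) r"
    and below: "\<And>v r. R v r \<Longrightarrow> (\<And>i. i \<ge> n \<Longrightarrow> v i = 0) \<Longrightarrow> (\<Sum>i<n. a i * rvec v i) \<le> r"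
  shows "\<exists>t. \<forall>v r. R v r \<longrightarrow> (\<forall>i\<ge>Suc n. v i = 0) \<longrightarrow> (\<Sum>i<Suc n. (a(n := t)) i * rvec v i) \<le> r"
proof -
  define S where "S v = (\<Sum>i<n. a i * rvec v i)" for v
  have S_add: "S (\<lambda>i. v i + w i) = S v + S w" for v w
    by (simp add: S_def rvec_def of_rat_add algebra_simps sum.distrib)
  have S_scale: "S (\<lambda>i. c * v i) = real_of_rat c * S v" for v c
    by (simp add: S_def rvec_def of_rat_mult sum_distrib_left algebra_simps)
  \<comment> \<open>The new coefficient \<open>t\<close> is squeezed between two families of bounds.
    Rescaling a constraint to \<open>v n = -1\<close> gives the lower bound \<open>S v - r\<close>,
    rescaling to \<open>w n = 1\<close> gives the upper bound \<open>r - S w\<close>. Adding one of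
    each cancels coordinate \<open>n\<close>, so \<open>below\<close> shows that they are
    compatible.\<close>
  define L where "L = {S v - r |v r. R v r \<and> v n = -1 \<and> (\<forall>i>n. v i = 0)}"
  have L_le: "l \<le> r - S w" if "l \<in> L" "R w r" "w n = 1" "\<forall>i>n. w i = 0" for l w r
  proof -
    obtain v s where v: "l = S v - s" "R v s" "v n = -1" "\<forall>i>n. v i = 0"
      using \<open>l \<in> L\<close> by (auto simp: L_def)
    have "v i + w i = 0" if "i \<ge> n" for i
      using that v \<open>w n = 1\<close> \<open>\<forall>i>n. w i = 0\<close> by (cases "i = n") auto
    then have "S (\<lambda>i. v i + w i) \<le> s + r"
      unfolding S_def using R_add [OF v(2) \<open>R w r\<close>] by (intro below) auto
    then show ?thesis by (simp add: S_add v)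
  qed
  \<comment> \<open>The unit vectors guarantee an upper bound and, with \<open>r1\<close>, a lower
    bound, so the supremum of \<open>L\<close> is meaningful.\<close>
  obtain r0 where r0: "R (\<lambda>i. if i = n then 1 else 0) r0" using R_unit by blast
  obtain r1 where r1: "R (\<lambda>i. if i = n then -1 else 0) r1" using R_unit by blast
  have "S (\<lambda>i. if i = n then -1 else 0) - r1 \<in> L"
    unfolding L_def using r1
    by (intro CollectI exI [of _ "\<lambda>i. if i = n then -1 else 0"] exI [of _ r1]) auto
  then have "L \<noteq> {}" by blast
  have "bdd_above L"
    by (rule bdd_aboveI [OF L_le [OF _ r0]]) auto
  define t where "t = Sup L"
  have "(\<Sum>i<Suc n. (a(n := t)) i * rvec v i) \<le> r" if v: "R v r" "\<forall>i\<ge>Suc n. v i = 0" for v r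
  proof -
    have v': "\<forall>i>n. v i = 0" using v by auto
    have eq: "(\<Sum>i<Suc n. (a(n := t)) i * rvec v i) = S v + t * rvec v n"
      by (simp add: S_def)
    consider "v n = 0" | "v n > 0" | "v n < 0" by linarith
    then have "S v + t * rvec v n \<le> r"
    proof cases
      case 1
      then have "v i = 0" if "i \<ge> n" for i
        using v' that by (cases "i = n") auto
      then show ?thesis
        using below [OF v(1)] 1 by (simp add: S_def rvec_def)
    next
      case 2
      let ?c = "inverse (v n)"
      have "t \<le> real_of_rat ?c * r - S (\<lambda>i. ?c * v i)"
        unfolding t_def using 2 v' R_scale [OF v(1), of ?c]
        by (intro cSup_least [OF \<open>L \<noteq> {}\<close>] L_le) auto
      then show ?thesis
        unfolding S_scale using 2 by (simp add: rvec_def of_rat_divide field_simps)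
    next
      case 3
      let ?c = "inverse (- v n)"
      have "S (\<lambda>i. ?c * v i) - real_of_rat ?c * r \<in> L"
        unfolding L_def using 3 v' R_scale [OF v(1), of ?c] by fastforce
      then have "S (\<lambda>i. ?c * v i) - real_of_rat ?c * r \<le> t"
        unfolding t_def using \<open>bdd_above L\<close> by (rule cSup_upper)
      moreover have neg: "rvec v n < 0" using 3 by (simp add: rvec_def)
      ultimately have "t * rvec v n \<le> (real_of_rat ?c * S v - real_of_rat ?c * r) * rvec v n"
        unfolding S_scale by (intro mult_right_mono_neg) auto
      also have "\<dots> = (real_of_rat ?c * rvec v n) * (S v - r)"
        by (simp add: algebra_simps)
      also have "real_of_rat ?c * rvec v n = -1"
        using 3 by (simp add: rvec_def of_rat_minus of_rat_inverse)
      finally show ?thesis by simp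
    qed
    with eq show ?thesis by simp
  qed
  then show ?thesis by blast
qed

text \<open>\<open>R v r\<close> is to be read as the demand that the functional be at most
  \<open>r\<close> at \<open>v\<close>. \<open>R_zero\<close> says that the demands at 0 are
  consistent and starts the recursion.\<close>

lemma cone_functional_exists:
  fixes R :: "(nat \<Rightarrow> rat) \<Rightarrow> real \<Rightarrow> bool"
  assumes R_V: "\<And>v r. R v r \<Longrightarrow> v \<in> Vset"
    and R_add: "\<And>v w r s. R v r \<Longrightarrow> R w s \<Longrightarrow> R (\<lambda>i. v i + w i) (r + s)"
    and R_scale: "\<And>v r c. R v r \<Longrightarrow> c > 0 \<Longrightarrow> R (\<lambda>i. c * v i) (real_of_rat c * r)"
    and R_unit: "\<And>n. \<exists>r. R (\<lambda>i. if i = n then 1 else 0) r" "\<And>n. \<exists>r. R (\<lambda>i. if i = n then -1 else 0) r"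
    and R_zero: "\<And>r. R (\<lambda>_. 0) r \<Longrightarrow> 0 \<le> r"
  obtains a :: "nat \<Rightarrow> real" where "\<And>v r. R v r \<Longrightarrow> (\<Sum>i | v i \<noteq> 0. a i * rvec v i) \<le> r"
proof -
  define P where "P n a \<longleftrightarrow> (\<forall>v r. R v r \<longrightarrow> (\<forall>i\<ge>n. v i = 0) \<longrightarrow> (\<Sum>i<n. a i * rvec v i) \<le> r)"
    for n and a :: "nat \<Rightarrow> real"
  have step: "\<exists>t. P (Suc n) (a(n := t))" if "P n a" for n a
    unfolding P_def by (rule cone_functional_step [OF R_add R_scale R_unit]) (use that P_def in auto)
  \<comment> \<open>Stage \<open>n\<close> fixes coefficient \<open>n\<close> and never touches the
    earlier ones, so the diagonal \<open>A (Suc i) i\<close> collects the final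
    coefficients.\<close>
  define A where "A = rec_nat (\<lambda>_. 0) (\<lambda>n a. a(n := (SOME t. P (Suc n) (a(n := t)))))"
  have A_Suc: "A (Suc n) = (A n)(n := (SOME t. P (Suc n) ((A n)(n := t))))" for n
    by (simp add: A_def)
  have PA: "P n (A n)" for n
  proof (induction n)
    case 0
    show ?case
      unfolding P_def
    proof (intro allI impI)
      fix v r assume "R v r" "\<forall>i\<ge>0. v i = 0"
      moreover from this have "v = (\<lambda>_. 0)" by auto
      ultimately show "(\<Sum>i<0. A 0 i * rvec v i) \<le> r"
        using R_zero by simp
    qed
  next
    case (Suc n)
    show ?case
      unfolding A_Suc by (rule someI_ex [OF step [OF Suc]])
  qed
  have A_stable: "A n i = A (Suc i) i" if "i < n" for n i
    using that by (induction n) (auto simp: A_Suc less_Suc_eq)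
  have "(\<Sum>i | v i \<noteq> 0. A (Suc i) i * rvec v i) \<le> r" if "R v r" for v r
  proof -
    have "finite {i. v i \<noteq> 0}"
      using R_V [OF that] by (simp add: Vset_def)
    then obtain n where n: "{i. v i \<noteq> 0} \<subseteq> {..<n}"
      using finite_nat_bounded by blast
    have "(\<Sum>i | v i \<noteq> 0. A (Suc i) i * rvec v i) = (\<Sum>i<n. A (Suc i) i * rvec v i)"
      using n by (intro sum.mono_neutral_left) (auto simp: rvec_def)
    also have "\<dots> = (\<Sum>i<n. A n i * rvec v i)"
      by (rule sum.cong) (simp_all add: A_stable [where n = n])
    also have "\<dots> \<le> r"
      using PA [of n] that n by (force simp: P_def)
    finally show ?thesis .
  qed
  then show ?thesis using that [of "\<lambda>i. A (Suc i) i"] by blast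
qed

text \<open>Equals the total weight times the difference of \<open>z\<close> and the weighted mean
  of the points. Leaving the weights unnormalised turns convex combinations into a cone: lists can
  be appended and rescaled without division.\<close>

definition weighted_defect :: "(nat \<Rightarrow> rat) \<Rightarrow> (rat \<times> (nat \<Rightarrow> rat)) list \<Rightarrow> nat \<Rightarrow> rat" where
  "weighted_defect z ps i = (\<Sum>(l, y)\<leftarrow>ps. l * (z i - y i))"

definition total_weight :: "(rat \<times> (nat \<Rightarrow> rat)) list \<Rightarrow> real" where
  "total_weight ps = (\<Sum>(l, y)\<leftarrow>ps. real_of_rat l)"

lemma weighted_defect_simps [simp]:
  "weighted_defect z [] = (\<lambda>_. 0)"
  "weighted_defect z ((l, y) # ps) = (\<lambda>i. l * (z i - y i) + weighted_defect z ps i)"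
  "weighted_defect z (ps @ qs) = (\<lambda>i. weighted_defect z ps i + weighted_defect z qs i)"
  by (auto simp: weighted_defect_def fun_eq_iff)

lemma total_weight_simps [simp]:
  "total_weight [] = 0"
  "total_weight ((l, y) # ps) = real_of_rat l + total_weight ps"
  "total_weight (ps @ qs) = total_weight ps + total_weight qs"
  by (auto simp: total_weight_def)

lemma weighted_defect_map_scale:
  "weighted_defect z (map (\<lambda>(l, y). (c * l, y)) ps) = (\<lambda>i. c * weighted_defect z ps i)"
  by (induction ps) (auto simp: algebra_simps)

lemma total_weight_map_scale:
  "total_weight (map (\<lambda>(l, y). (c * l, y)) ps) = real_of_rat c * total_weight ps"
  by (induction ps) (auto simp: algebra_simps of_rat_mult)

definition weights_in :: "(nat \<Rightarrow> rat) set \<Rightarrow> (rat \<times> (nat \<Rightarrow> rat)) list \<Rightarrow> bool" where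
  "weights_in Y ps \<longleftrightarrow> (\<forall>(l, y)\<in>set ps. 0 \<le> l \<and> y \<in> Y)"

lemma weights_in_simps [simp]:
  "weights_in Y []"
  "weights_in Y ((l, y) # ps) \<longleftrightarrow> 0 \<le> l \<and> y \<in> Y \<and> weights_in Y ps"
  "weights_in Y (ps @ qs) \<longleftrightarrow> weights_in Y ps \<and> weights_in Y qs"
  by (auto simp: weights_in_def)

lemma weights_in_map_scale:
  "weights_in Y ps \<Longrightarrow> 0 \<le> c \<Longrightarrow> weights_in Y (map (\<lambda>(l, y). (c * l, y)) ps)"
  by (auto simp: weights_in_def)

lemma total_weight_nonneg: "weights_in Y ps \<Longrightarrow> 0 \<le> total_weight ps"
  by (induction ps) auto

lemma weighted_defect_Vset: "weights_in Y ps \<Longrightarrow> Y \<subseteq> Vset \<Longrightarrow> z \<in> Vset \<Longrightarrow> weighted_defect z ps \<in> Vset"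
proof (induction ps)
  case (Cons p ps)
  then show ?case
    by (cases p) (auto intro!: Vset_add Vset_scale)
qed auto

text \<open>Both inequalities are strict, so that for a fixed \<open>y\<close> membership is an open
  condition on \<open>\<mu>\<close>.\<close>

definition far_points :: "((nat \<Rightarrow> rat) \<Rightarrow> real) \<Rightarrow> (nat \<Rightarrow> rat) \<Rightarrow> real \<Rightarrow> (nat \<Rightarrow> rat) set" where
  "far_points \<mu> x e = {y \<in> Vset. \<mu> y < 1 \<and> \<mu> (\<lambda>i. x i - y i) > 2 - e}"

text \<open>Up to normalising the weights: \<open>z\<close> is within \<open>e\<close> of the convex hull of the points of the
  unit ball that are almost antipodal to \<open>x\<close>.\<close>
definition near_hull :: "((nat \<Rightarrow> rat) \<Rightarrow> real) \<Rightarrow> (nat \<Rightarrow> rat) \<Rightarrow> (nat \<Rightarrow> rat) \<Rightarrow> real \<Rightarrow> bool" where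
  "near_hull \<mu> x z e \<longleftrightarrow> (\<exists>ps. weights_in (far_points \<mu> x e) ps \<and>
     \<mu> (weighted_defect z ps) < e * total_weight ps)"

context
  fixes \<mu> assumes mu: "\<mu> \<in> Pset"
begin

interpretation c00_seminorm "mubar \<mu>"
  using mu by (rule mubar_seminorm)

text \<open>A functional below the seminorm cannot be smaller by the full tolerance at every point
  of the list: summing with the weights would make it too large at the defect. So some far point on
  the list competes with \<open>z\<close>.\<close>

lemma Daugavet_if_near_hull:
  assumes H: "\<And>x z e. x \<in> Vset \<Longrightarrow> z \<in> Vset \<Longrightarrow> \<mu> x > 1 \<Longrightarrow> \<mu> z < 1 \<Longrightarrow> e > 0 \<Longrightarrow> near_hull \<mu> x z e"
  shows "Daugavet \<mu>"
proof (rule Daugavet_if_on_c00 [OF mu])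
  fix f x z and e :: real
  assume f: "c00_linear f" and fle: "\<And>v. v \<in> c00 \<Longrightarrow> f v \<le> mubar \<mu> v"
    and x: "x \<in> c00" "mubar \<mu> x > 1" and z: "z \<in> c00" "mubar \<mu> z < 1" and "e > 0"
  note lin = c00_linearD [OF f]
  \<comment> \<open>The second entry of the minimum keeps the rational approximation on the same
    side of norm 1; likewise for \<open>z'\<close>.\<close>
  obtain x' where x': "x' \<in> Vset" "mubar \<mu> (\<lambda>i. x i - rvec x' i) < min (e / 2) (mubar \<mu> x - 1)"
    using Vset_dense [OF mu x(1), of "min (e / 2) (mubar \<mu> x - 1)"] x \<open>e > 0\<close> by auto
  obtain z' where z': "z' \<in> Vset" "mubar \<mu> (\<lambda>i. z i - rvec z' i) < min (e / 2) (1 - mubar \<mu> z)"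
    using Vset_dense [OF mu z(1), of "min (e / 2) (1 - mubar \<mu> z)"] z \<open>e > 0\<close> by auto
  have "\<mu> x' > 1"
    using le_add_diff [OF x(1) rvec_c00 [OF x'(1)]] x' mubar_rvec [OF mu] by simp
  moreover have "\<mu> z' < 1"
    using le_add_diff [OF rvec_c00 [OF z'(1)] z(1)] z' mubar_rvec [OF mu]
      minus_commute [OF rvec_c00 [OF z'(1)] z(1)] by simp
  ultimately have "near_hull \<mu> x' z' (e / 2)"
    using x' z' \<open>e > 0\<close> by (intro H) auto
  then obtain ps where ps: "weights_in (far_points \<mu> x' (e / 2)) ps"
      "\<mu> (weighted_defect z' ps) < e / 2 * total_weight ps"
    by (auto simp: near_hull_def)
  have fy: "f (rvec (weighted_defect z' qs)) \<ge> e / 2 * total_weight qs"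
    if "weights_in (far_points \<mu> x' (e / 2)) qs" "\<And>l y. (l, y) \<in> set qs \<Longrightarrow> f (rvec z') - f (rvec y) \<ge> e / 2" for qs
    using that
  proof (induction qs)
    case Nil
    then show ?case using c00_linear_zero [OF f] by (simp add: rvec_def)
  next
    case (Cons p qs)
    obtain l y where p: "p = (l, y)" by (cases p)
    have y: "rvec y \<in> c00" "rvec z' \<in> c00" "rvec (weighted_defect z' qs) \<in> c00" "l \<ge> 0"
      using Cons.prems(1) p z' weighted_defect_Vset [of "far_points \<mu> x' (e / 2)" qs z']
      by (auto simp: far_points_def)
    have "rvec (weighted_defect z' (p # qs)) =
        (\<lambda>i. real_of_rat l * (rvec z' i - rvec y i) + 1 * rvec (weighted_defect z' qs) i)"
      by (auto simp: p rvec_def of_rat_add of_rat_mult of_rat_diff)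
    then have "f (rvec (weighted_defect z' (p # qs))) =
        real_of_rat l * (f (rvec z') - f (rvec y)) + f (rvec (weighted_defect z' qs))"
      using lin(1) [OF c00_diff [OF y(2) y(1)] y(3), of "real_of_rat l" 1] lin(3) [OF y(2,1)] by simp
    moreover have "real_of_rat l * (f (rvec z') - f (rvec y)) \<ge> real_of_rat l * (e / 2)"
      using Cons.prems(2) [of l y] p y(4) by (intro mult_left_mono) auto
    moreover have "f (rvec (weighted_defect z' qs)) \<ge> e / 2 * total_weight qs"
      using Cons by (intro Cons.IH) (auto simp: p)
    ultimately show ?case by (simp add: p algebra_simps)
  qed
  have "f (rvec (weighted_defect z' ps)) \<le> \<mu> (weighted_defect z' ps)"
    using fle weighted_defect_Vset [OF ps(1) _ z'(1)] mubar_rvec [OF mu]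
    by (metis (no_types, lifting) far_points_def mem_Collect_eq rvec_c00 subsetI)
  then obtain l y where y: "(l, y) \<in> set ps" "f (rvec z') - f (rvec y) < e / 2"
    using fy [OF ps(1)] ps(2) by force
  then have far: "y \<in> Vset" "\<mu> y < 1" "\<mu> (\<lambda>i. x' i - y i) > 2 - e / 2"
    using ps(1) by (auto simp: weights_in_def far_points_def)
  note c = rvec_c00 [OF far(1)] rvec_c00 [OF x'(1)] rvec_c00 [OF z'(1)]
  have "mubar \<mu> (\<lambda>i. rvec x' i - rvec y i) > 2 - e / 2"
    using mubar_rvec [OF mu Vset_diff [OF x'(1) far(1)]] far(3) by (simp add: rvec_diff)
  then have "mubar \<mu> (\<lambda>i. x i - rvec y i) > 2 - e"
    using triangle [OF c(2) x(1) c(1)] minus_commute [OF c(2) x(1)] x' by simp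
  moreover have "f (rvec y) > f z - e"
    using y(2) fle [OF c00_diff [OF z(1) c(3)]] lin(3) [OF z(1) c(3)] z' by simp
  ultimately show "\<exists>y\<in>c00. mubar \<mu> y < 1 \<and> f y > f z - e \<and> mubar \<mu> (\<lambda>i. x i - y i) > 2 - e"
    using far mubar_rvec [OF mu far(1)] c by (intro bexI [of _ "rvec y"]) auto
qed

text \<open>If \<open>z\<close> stays away from the hull, separation gives a functional below the
  seminorm whose value at \<open>z\<close> exceeds that at every far point by a fixed amount. The
  Daugavet property for this functional produces a far point violating the gap.\<close>

lemma near_hull_if_Daugavet:
  assumes D: "Daugavet \<mu>" and x: "x \<in> Vset" "\<mu> x > 1" and z: "z \<in> Vset" "\<mu> z < 1" and "e > 0"
  shows "near_hull \<mu> x z e"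
proof (rule ccontr)
  assume not_near: "\<not> near_hull \<mu> x z e"
  \<comment> \<open>The cap 1 keeps the gap below \<open>\<mu> x\<close>, which is the seminorm of
    the defect of the substitute point chosen next.\<close>
  define e0 where "e0 = min e 1"
  have e0: "e0 > 0" "e0 \<le> e" "e0 \<le> 1" using \<open>e > 0\<close> by (auto simp: e0_def)
  let ?Y0 = "far_points \<mu> x e"
  \<comment> \<open>Without far points the separation would be vacuous and the functional might be
    zero, which \<open>Daugavet_on_c00\<close> does not admit. The substitute \<open>z - x\<close>
    has defect \<open>x\<close>, of seminorm above 1, and forces a nonzero value.\<close>
  define Y where "Y = (if ?Y0 = {} then {\<lambda>i. z i - x i} else ?Y0)"
  have Y: "Y \<noteq> {}" "Y \<subseteq> Vset"
    using x z by (auto simp: Y_def far_points_def)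
  have sep: "\<mu> (weighted_defect z ps) \<ge> e0 * total_weight ps" if ps: "weights_in Y ps" for ps
  proof (cases "?Y0 = {}")
    case False
    then have "\<mu> (weighted_defect z ps) \<ge> e * total_weight ps"
      using not_near ps by (auto simp: near_hull_def Y_def not_less)
    moreover have "e0 * total_weight ps \<le> e * total_weight ps"
      using e0 total_weight_nonneg [OF ps] by (intro mult_right_mono)
    ultimately show ?thesis by linarith
  next
    case True
    with ps have "weighted_defect z ps = (\<lambda>i. (\<Sum>(l, y)\<leftarrow>ps. l) * x i) \<and>
        real_of_rat (\<Sum>(l, y)\<leftarrow>ps. l) = total_weight ps"
      by (induction ps) (auto simp: Y_def algebra_simps of_rat_add)
    moreover from this have "(\<Sum>(l, y)\<leftarrow>ps. l) \<ge> 0"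
      using total_weight_nonneg [OF ps] by (metis zero_le_of_rat_iff)
    ultimately have "\<mu> (weighted_defect z ps) = total_weight ps * \<mu> x"
      using Pset_scale [OF mu x(1)] by auto
    moreover have "total_weight ps * e0 \<le> total_weight ps * \<mu> x"
      using total_weight_nonneg [OF ps] e0 x by (intro mult_left_mono) auto
    ultimately show ?thesis by (simp add: mult.commute)
  qed
  \<comment> \<open>The demands combine domination and separation: the empty list requires
    \<open>f \<le> \<mu>\<close>, and the list \<open>[(1, y)]\<close> at \<open>y - z\<close>
    requires \<open>f (z - y) \<ge> e0\<close>. Consistency at 0 is exactly
    \<open>sep\<close>.\<close>
  define R where "R v r \<longleftrightarrow> v \<in> Vset \<and> (\<exists>ps. weights_in Y ps \<and>
      \<mu> (\<lambda>i. v i + weighted_defect z ps i) - e0 * total_weight ps \<le> r)" for v r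
  obtain a where a: "\<And>v r. R v r \<Longrightarrow> (\<Sum>i | v i \<noteq> 0. a i * rvec v i) \<le> r"
  proof (rule cone_functional_exists [of R])
    show "v \<in> Vset" if "R v r" for v r
      using that by (simp add: R_def)
    show "R (\<lambda>i. v i + w i) (r + s)" if vw: "R v r" "R w s" for v w r s
    proof -
      obtain ps qs where ps: "weights_in Y ps" "\<mu> (\<lambda>i. v i + weighted_defect z ps i) - e0 * total_weight ps \<le> r"
        and qs: "weights_in Y qs" "\<mu> (\<lambda>i. w i + weighted_defect z qs i) - e0 * total_weight qs \<le> s"
        using vw by (auto simp: R_def)
      have V: "v \<in> Vset" "w \<in> Vset" using vw by (auto simp: R_def)
      have "\<mu> (\<lambda>i. (v i + weighted_defect z ps i) + (w i + weighted_defect z qs i))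
          \<le> \<mu> (\<lambda>i. v i + weighted_defect z ps i) + \<mu> (\<lambda>i. w i + weighted_defect z qs i)"
        by (intro Pset_add [OF mu] Vset_add V weighted_defect_Vset [OF _ Y(2) z(1)] ps qs)
      then have "\<mu> (\<lambda>i. (v i + w i) + weighted_defect z (ps @ qs) i) - e0 * total_weight (ps @ qs) \<le> r + s"
        using ps qs by (simp add: algebra_simps)
      then show ?thesis
        using V ps qs unfolding R_def by (intro conjI exI [of _ "ps @ qs"]) auto
    qed
    show "R (\<lambda>i. c * v i) (real_of_rat c * r)" if v: "R v r" "c > 0" for v r c
    proof -
      obtain ps where ps: "weights_in Y ps" "\<mu> (\<lambda>i. v i + weighted_defect z ps i) - e0 * total_weight ps \<le> r"
        using v by (auto simp: R_def)
      have V: "v \<in> Vset" using v by (auto simp: R_def)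
      let ?qs = "map (\<lambda>(l, y). (c * l, y)) ps"
      have "\<mu> (\<lambda>i. c * (v i + weighted_defect z ps i)) = real_of_rat c * \<mu> (\<lambda>i. v i + weighted_defect z ps i)"
        using v(2) Pset_scale [OF mu Vset_add [OF V weighted_defect_Vset [OF ps(1) Y(2) z(1)]]] by simp
      then have "\<mu> (\<lambda>i. c * v i + weighted_defect z ?qs i) - e0 * total_weight ?qs
          = real_of_rat c * (\<mu> (\<lambda>i. v i + weighted_defect z ps i) - e0 * total_weight ps)"
        by (simp add: weighted_defect_map_scale total_weight_map_scale right_diff_distrib distrib_left)
      also have "\<dots> \<le> real_of_rat c * r"
        using ps(2) v(2) by (intro mult_left_mono) auto
      finally show ?thesis
        using V v(2) weights_in_map_scale [OF ps(1), of c] unfolding R_def by (intro conjI exI [of _ ?qs]) auto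
    qed
    show "\<exists>r. R (\<lambda>i. if i = n then 1 else 0) r" "\<exists>r. R (\<lambda>i. if i = n then -1 else 0) r" for n
      unfolding R_def by (auto intro!: exI [of _ "[]"])
    show "0 \<le> r" if "R (\<lambda>_. 0) r" for r
      using that sep by (force simp: R_def)
  qed (use that in blast)
  define f where "f u = (\<Sum>i | u i \<noteq> 0. a i * u i)" for u :: "nat \<Rightarrow> real"
  have f_eq: "f u = (\<Sum>i\<in>F. a i * u i)" if "finite F" "\<And>i. i \<notin> F \<Longrightarrow> u i = 0" for F u
    unfolding f_def using that by (intro sum.mono_neutral_left) auto
  have f: "c00_linear f"
    unfolding c00_linear_def
  proof (intro ballI allI)
    fix u w :: "nat \<Rightarrow> real" and b c :: real assume "u \<in> c00" "w \<in> c00"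
    then have "finite ({i. u i \<noteq> 0} \<union> {i. w i \<noteq> 0})" (is "finite ?F")
      by (simp add: c00_def)
    then have "f u = (\<Sum>i\<in>?F. a i * u i)" "f w = (\<Sum>i\<in>?F. a i * w i)"
      "f (\<lambda>i. b * u i + c * w i) = (\<Sum>i\<in>?F. a i * (b * u i + c * w i))"
      by (intro f_eq; simp)+
    then show "f (\<lambda>i. b * u i + c * w i) = b * f u + c * f w"
      by (simp add: sum_distrib_left sum.distrib algebra_simps)
  qed
  note lin = c00_linearD [OF f]
  have fR: "f (rvec v) \<le> r" if "R v r" for v r
    using a [OF that] by (simp add: f_def rvec_def)
  have fle: "f u \<le> mubar \<mu> u" if u: "u \<in> c00" for u
  proof (rule LIMSEQ_le [OF _ mubar_qapprox [OF mu u]])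
    let ?F = "{i. u i \<noteq> 0}"
    have F: "finite ?F" using u by (simp add: c00_def)
    have "(\<lambda>k. \<Sum>i\<in>?F. a i * rvec (qapprox u k) i) \<longlonglongrightarrow> (\<Sum>i\<in>?F. a i * u i)"
      unfolding rvec_def by (intro tendsto_intros qapprox_tendsto)
    then show "(\<lambda>k. f (rvec (qapprox u k))) \<longlonglongrightarrow> f u"
      using f_eq [OF F, of "rvec (qapprox u _)"] by (simp add: rvec_def qapprox_eq_0 f_def)
    have "R (qapprox u k) (\<mu> (qapprox u k))" for k
      unfolding R_def using u by (auto intro!: exI [of _ "[]"])
    then show "\<exists>N. \<forall>k\<ge>N. f (rvec (qapprox u k)) \<le> \<mu> (qapprox u k)"
      using fR by blast
  qed
  have fY: "f (\<lambda>i. rvec z i - rvec y i) \<ge> e0" if "y \<in> Y" for y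
  proof -
    have y: "y \<in> Vset" using that Y by blast
    have "R (\<lambda>i. y i - z i) (- e0)"
      unfolding R_def using that y z Pset_zero [OF mu] by (auto intro!: exI [of _ "[(1, y)]"])
    then have "f (rvec (\<lambda>i. y i - z i)) \<le> - e0" by (rule fR)
    then show ?thesis
      using lin(3) y z by (simp add: rvec_diff)
  qed
  obtain y1 where y1: "y1 \<in> Y" using Y by blast
  have nz: "(\<lambda>i. rvec z i - rvec y1 i) \<in> c00" "f (\<lambda>i. rvec z i - rvec y1 i) \<noteq> 0"
    using fY [OF y1] e0 Y y1 z by auto
  obtain y where y: "y \<in> c00" "mubar \<mu> y < 1" "f y > f (rvec z) - e0 / 2"
    "mubar \<mu> (\<lambda>i. rvec x i - y i) > 2 - e0 / 2"
    using Daugavet_on_c00 [OF mu D f fle nz, of "rvec x" "rvec z" "e0 / 2"] x z e0 mubar_rvec [OF mu] by auto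
  obtain y' where y': "y' \<in> Vset" "mubar \<mu> (\<lambda>i. y i - rvec y' i) < min (e0 / 2) (1 - mubar \<mu> y)"
    using Vset_dense [OF mu y(1), of "min (e0 / 2) (1 - mubar \<mu> y)"] y e0 by auto
  note c = rvec_c00 [OF y'(1)] rvec_c00 [OF x(1)] rvec_c00 [OF z(1)]
  have "\<mu> y' < 1"
    using le_add_diff [OF c(1) y(1)] y' mubar_rvec [OF mu] minus_commute [OF c(1) y(1)] by simp
  moreover have "mubar \<mu> (\<lambda>i. rvec x i - rvec y' i) > 2 - e"
    using triangle [OF c(2) c(1) y(1)] minus_commute [OF c(1) y(1)] y' y(4) e0 by simp
  then have "\<mu> (\<lambda>i. x i - y' i) > 2 - e"
    using mubar_rvec [OF mu Vset_diff [OF x(1) y'(1)]] by (simp add: rvec_diff)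
  ultimately have "y' \<in> ?Y0"
    using y' by (simp add: far_points_def)
  then have "y' \<in> Y" by (auto simp: Y_def)
  then have "f (rvec z) - f (rvec y') \<ge> e0"
    using fY lin(3) c by metis
  moreover have "f y - f (rvec y') < e0 / 2"
    using fle [OF c00_diff [OF y(1) c(1)]] lin(3) [OF y(1) c(1)] y' by simp
  ultimately show False using y(3) by linarith
qed

end

section \<open>Openness of the tests\<close>

lemma openin_RV_coordinate:
  assumes "v \<in> Vset"
  shows "openin RV {\<mu> \<in> topspace RV. \<mu> v < c}" "openin RV {\<mu> \<in> topspace RV. \<mu> v > c}"
proof -
  have "continuous_map RV euclideanreal (\<lambda>\<mu>. \<mu> v)"
    unfolding RV_def using assms by (rule continuous_map_product_projection)
  then show "openin RV {\<mu> \<in> topspace RV. \<mu> v < c}" "openin RV {\<mu> \<in> topspace RV. \<mu> v > c}"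
    by (simp_all add: continuous_map_upper_lower_semicontinuous_lt)
qed

text \<open>A fixed list imposes finitely many strict inequalities on values of
  \<open>\<mu>\<close>; the set is the union over all lists.\<close>

lemma openin_near_hull:
  assumes x: "x \<in> Vset" and z: "z \<in> Vset"
  shows "openin RV {\<mu> \<in> topspace RV. near_hull \<mu> x z e}"
proof -
  define W where "W p = {\<mu> \<in> topspace RV. \<mu> (snd p) < 1} \<inter> {\<mu> \<in> topspace RV. \<mu> (\<lambda>i. x i - snd p i) > 2 - e}"
    for p :: "rat \<times> (nat \<Rightarrow> rat)"
  have eq: "{\<mu> \<in> topspace RV. near_hull \<mu> x z e} =
    (\<Union>ps\<in>{ps. weights_in Vset ps}. {\<mu> \<in> topspace RV. \<mu> (weighted_defect z ps) < e * total_weight ps} \<inter> \<Inter>(W ` set ps))"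
    unfolding near_hull_def weights_in_def far_points_def W_def by fastforce
  show ?thesis
    unfolding eq
  proof (rule openin_Union, clarify)
    fix ps :: "(rat \<times> (nat \<Rightarrow> rat)) list" assume ps: "weights_in Vset ps"
    show "openin RV ({\<mu> \<in> topspace RV. \<mu> (weighted_defect z ps) < e * total_weight ps} \<inter> \<Inter>(W ` set ps))"
    proof (rule openin_Int_Inter)
      show "openin RV {\<mu> \<in> topspace RV. \<mu> (weighted_defect z ps) < e * total_weight ps}"
        using weighted_defect_Vset [OF ps _ z] by (intro openin_RV_coordinate) auto
      show "openin RV S" if "S \<in> W ` set ps" for S
      proof -
        from that obtain l y where "(l, y) \<in> set ps" "S = W (l, y)" by auto
        moreover from this have "y \<in> Vset" using ps by (auto simp: weights_in_def)
        ultimately show ?thesis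
          using x by (auto simp: W_def intro!: openin_Int openin_RV_coordinate)
      qed
    qed auto
  qed
qed

text \<open>An implication with the open premises \<open>\<mu> x > 1\<close> and
  \<open>\<mu> z < 1\<close> need not be an open condition. Premises with a margin are closed, so
  their negations can join as open disjuncts, and every strict inequality has some margin
  \<open>1 / Suc k\<close>.\<close>

lemma Daugavet_iff_near_hull:
  assumes mu: "\<mu> \<in> Pset"
  shows "Daugavet \<mu> \<longleftrightarrow> (\<forall>x\<in>Vset. \<forall>z\<in>Vset. \<forall>k::nat. \<mu> x < 1 + 1 / Suc k \<or> \<mu> z > 1 - 1 / Suc k \<or>
    near_hull \<mu> x z (1 / Suc k))"
proof
  assume D: "Daugavet \<mu>"
  show "\<forall>x\<in>Vset. \<forall>z\<in>Vset. \<forall>k::nat. \<mu> x < 1 + 1 / Suc k \<or> \<mu> z > 1 - 1 / Suc k \<or>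
    near_hull \<mu> x z (1 / Suc k)"
  proof (intro ballI allI)
    fix x z :: "nat \<Rightarrow> rat" and k :: nat assume V: "x \<in> Vset" "z \<in> Vset"
    have "(0::real) < 1 / Suc k" by simp
    with near_hull_if_Daugavet [OF mu D V(1) _ V(2)]
    show "\<mu> x < 1 + 1 / Suc k \<or> \<mu> z > 1 - 1 / Suc k \<or> near_hull \<mu> x z (1 / Suc k)"
      by (smt (verit))
  qed
next
  assume H: "\<forall>x\<in>Vset. \<forall>z\<in>Vset. \<forall>k::nat. \<mu> x < 1 + 1 / Suc k \<or> \<mu> z > 1 - 1 / Suc k \<or>
    near_hull \<mu> x z (1 / Suc k)"
  show "Daugavet \<mu>"
  proof (rule Daugavet_if_near_hull [OF mu])
    fix x z :: "nat \<Rightarrow> rat" and e :: real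
    assume V: "x \<in> Vset" "z \<in> Vset" and lt: "\<mu> x > 1" "\<mu> z < 1" "e > 0"
    \<comment> \<open>One index \<open>k\<close> serves both margins and the tolerance, because
      being near the hull is monotone in the tolerance.\<close>
    define d where "d = min e (min (\<mu> x - 1) (1 - \<mu> z))"
    have "d > 0" using lt by (simp add: d_def)
    then obtain k where k: "1 / Suc k < d" by (rule nat_approx_posE)
    then have "near_hull \<mu> x z (1 / Suc k)"
      using H V by (force simp: d_def)
    then obtain ps where ps: "weights_in (far_points \<mu> x (1 / Suc k)) ps"
        "\<mu> (weighted_defect z ps) < 1 / Suc k * total_weight ps"
      unfolding near_hull_def by blast
    have "far_points \<mu> x (1 / Suc k) \<subseteq> far_points \<mu> x e"
      using k by (auto simp: far_points_def d_def)
    then have "weights_in (far_points \<mu> x e) ps"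
      using ps(1) by (auto simp: weights_in_def)
    moreover have "1 / Suc k * total_weight ps \<le> e * total_weight ps"
      using k total_weight_nonneg [OF ps(1)] by (intro mult_right_mono) (auto simp: d_def)
    ultimately show "near_hull \<mu> x z e"
      unfolding near_hull_def using ps(2) by (intro exI [of _ ps]) linarith
  qed
qed

lemma gdelta_in_Daugavet:
  assumes I: "I \<subseteq> Pset"
  shows "gdelta_in (subtopology RV I) {\<mu> \<in> I. Daugavet \<mu>}"
proof -
  have IR: "I \<subseteq> topspace RV" using I by (auto simp: Pset_def)
  define U where "U = (\<lambda>(x, z, k). I \<inter> {\<mu> \<in> topspace RV. \<mu> x < 1 + 1 / real (Suc k) \<or> \<mu> z > 1 - 1 / real (Suc k) \<or>
      near_hull \<mu> x z (1 / real (Suc k))})"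
  have eq: "{\<mu> \<in> I. Daugavet \<mu>} = \<Inter>(U ` (Vset \<times> Vset \<times> (UNIV :: nat set)))"
  proof (intro set_eqI iffI)
    fix \<mu> assume "\<mu> \<in> {\<mu> \<in> I. Daugavet \<mu>}"
    then show "\<mu> \<in> \<Inter>(U ` (Vset \<times> Vset \<times> (UNIV :: nat set)))"
      using Daugavet_iff_near_hull [of \<mu>] I IR by (auto simp: U_def simp del: of_nat_Suc)
  next
    fix \<mu> assume H: "\<mu> \<in> \<Inter>(U ` (Vset \<times> Vset \<times> (UNIV :: nat set)))"
    then have "\<mu> \<in> U (\<lambda>_. 0, \<lambda>_. 0, 0)" using Vset_zero by blast
    then have "\<mu> \<in> I" by (simp add: U_def)
    moreover have "Daugavet \<mu>"
      using Daugavet_iff_near_hull [of \<mu>] I \<open>\<mu> \<in> I\<close> H by (fastforce simp: U_def simp del: of_nat_Suc)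
    ultimately show "\<mu> \<in> {\<mu> \<in> I. Daugavet \<mu>}" by simp
  qed
  have "gdelta_in (subtopology RV I) (U p)" if p: "p \<in> Vset \<times> Vset \<times> (UNIV :: nat set)" for p
  proof (rule open_imp_gdelta_in)
    obtain x z k where p': "p = (x, z, k)" "x \<in> Vset" "z \<in> Vset" using p by auto
    have "{\<mu> \<in> topspace RV. \<mu> x < 1 + 1 / real (Suc k) \<or> \<mu> z > 1 - 1 / real (Suc k) \<or>
        near_hull \<mu> x z (1 / real (Suc k))} =
      {\<mu> \<in> topspace RV. \<mu> x < 1 + 1 / real (Suc k)} \<union> {\<mu> \<in> topspace RV. \<mu> z > 1 - 1 / real (Suc k)} \<union>
      {\<mu> \<in> topspace RV. near_hull \<mu> x z (1 / real (Suc k))}"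
      by auto
    also have "openin RV \<dots>"
      using p' by (intro openin_Un openin_RV_coordinate openin_near_hull)
    finally show "openin (subtopology RV I) (U p)"
      unfolding p' U_def by (auto simp: openin_subtopology Int_commute)
  qed
  then show ?thesis
    unfolding eq by (intro gdelta_in_Inter) (use countable_Vset Vset_zero in \<open>auto simp del: Vset_zero\<close>)
qed

section \<open>Spaces of integrable functions over Bernoulli product measures\<close>

text \<open>Index \<open>i\<close> stands for the product of the coordinates in \<open>set_decode i\<close>, so \<open>cylinder_sum x\<close> is the
  function on subsets of \<open>nat\<close> (points of the Cantor space) with coefficients \<open>x\<close>.\<close>
definition cylinder_sum :: "(nat \<Rightarrow> real) \<Rightarrow> nat set \<Rightarrow> real" where
  "cylinder_sum x S = (\<Sum>i | x i \<noteq> 0 \<and> set_decode i \<subseteq> S. x i)"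

text \<open>The function \<open>cylinder_sum x\<close> depends on these coordinates only, so for
  \<open>x\<close> in \<open>c00\<close> all integrals become finite sums.\<close>

definition coords :: "(nat \<Rightarrow> real) \<Rightarrow> nat set" where
  "coords x = (\<Union>i\<in>{i. x i \<noteq> 0}. set_decode i)"

lemma finite_coords [simp]: "x \<in> c00 \<Longrightarrow> finite (coords x)"
  by (simp add: coords_def c00_def)

lemma cylinder_sum_eq:
  assumes "finite F" "\<And>i. i \<notin> F \<Longrightarrow> x i = 0"
  shows "cylinder_sum x S = (\<Sum>i\<in>F. of_bool (set_decode i \<subseteq> S) * x i)"
proof -
  have "cylinder_sum x S = (\<Sum>i | x i \<noteq> 0 \<and> set_decode i \<subseteq> S. of_bool (set_decode i \<subseteq> S) * x i)"
    unfolding cylinder_sum_def by (rule sum.cong) auto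
  also have "\<dots> = (\<Sum>i\<in>F. of_bool (set_decode i \<subseteq> S) * x i)"
    using assms by (intro sum.mono_neutral_left) auto
  finally show ?thesis .
qed

lemma c00_linear_cylinder_sum: "c00_linear (\<lambda>x. cylinder_sum x S)"
  unfolding c00_linear_def
proof (intro ballI allI)
  fix x y :: "nat \<Rightarrow> real" and a b :: real assume "x \<in> c00" "y \<in> c00"
  then have F: "finite ({i. x i \<noteq> 0} \<union> {i. y i \<noteq> 0})" (is "finite ?F")
    by (simp add: c00_def)
  have "cylinder_sum x S = (\<Sum>i\<in>?F. of_bool (set_decode i \<subseteq> S) * x i)"
    "cylinder_sum y S = (\<Sum>i\<in>?F. of_bool (set_decode i \<subseteq> S) * y i)"
    "cylinder_sum (\<lambda>i. a * x i + b * y i) S = (\<Sum>i\<in>?F. of_bool (set_decode i \<subseteq> S) * (a * x i + b * y i))"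
    by (intro cylinder_sum_eq [OF F]; simp)+
  then show "cylinder_sum (\<lambda>i. a * x i + b * y i) S = a * cylinder_sum x S + b * cylinder_sum y S"
    by (simp add: sum_distrib_left sum.distrib algebra_simps)
qed

lemmas cylinder_sum_linear = c00_linearD [OF c00_linear_cylinder_sum]

lemma cylinder_sum_Int: "coords x \<subseteq> A \<Longrightarrow> cylinder_sum x (S \<inter> A) = cylinder_sum x S"
  unfolding cylinder_sum_def coords_def by (rule sum.cong) auto

lemma cylinder_sum_empty: "cylinder_sum x {} = x 0"
proof -
  have "i = 0" if "set_decode i = {}" for i
    using subset_decode_imp_le [of i 0] that by simp
  then have "{i. x i \<noteq> 0 \<and> set_decode i \<subseteq> {}} = (if x 0 = 0 then {} else {0})"
    by auto
  then show ?thesis by (simp add: cylinder_sum_def)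
qed

text \<open>Linear independence of the monomials by triangularity: subsets have smaller codes, so at
  the set coded by the least index in the support only that coefficient is seen.\<close>

lemma cylinder_sum_nonzero:
  assumes "x \<in> c00" "x \<noteq> (\<lambda>_. 0)"
  obtains S where "S \<subseteq> coords x" "cylinder_sum x S \<noteq> 0"
proof -
  define n where "n = (LEAST i. x i \<noteq> 0)"
  have n: "x n \<noteq> 0"
    unfolding n_def by (rule LeastI_ex) (use assms in auto)
  have less: "x i = 0" if "i < n" for i
    using not_less_Least [of i "\<lambda>i. x i \<noteq> 0"] that by (auto simp: n_def)
  have "i = n" if "x i \<noteq> 0" "set_decode i \<subseteq> set_decode n" for i
    using less [of i] subset_decode_imp_le [OF that(2)] that(1) by linarith
  then have "{i. x i \<noteq> 0 \<and> set_decode i \<subseteq> set_decode n} = {n}"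
    using n by auto
  then have "cylinder_sum x (set_decode n) = x n"
    by (simp add: cylinder_sum_def)
  then show ?thesis
    using that [of "set_decode n"] n by (auto simp: coords_def)
qed

text \<open>Moebius inversion on finite sets. It recurses along codes: proper subsets have smaller
  ones.\<close>

fun moebius :: "(nat set \<Rightarrow> real) \<Rightarrow> nat \<Rightarrow> real" where
  "moebius \<phi> n = \<phi> (set_decode n) - (\<Sum>i | i < n \<and> set_decode i \<subseteq> set_decode n. moebius \<phi> i)"

declare moebius.simps [simp del]

text \<open>Every function on a finite cube is a polynomial in the coordinates; this supplies the
  normalised restrictions to cells used in both directions of the dichotomy.\<close>

lemma cylinder_sum_surj:
  assumes A: "finite A"
  obtains x where "x \<in> c00" "coords x \<subseteq> A" "\<And>S. S \<subseteq> A \<Longrightarrow> cylinder_sum x S = \<phi> S"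
proof -
  define x where "x n = (if set_decode n \<subseteq> A then moebius \<phi> n else 0)" for n
  have "{n. set_decode n \<subseteq> A} \<subseteq> set_encode ` Pow A"
    by (force intro: set_decode_inverse [symmetric])
  then have fin: "finite {n. set_decode n \<subseteq> A}"
    using A finite_subset by blast
  have "x \<in> c00"
    by (rule c00_I [OF fin]) (simp add: x_def)
  moreover have "coords x \<subseteq> A"
    by (auto simp: coords_def x_def split: if_splits)
  moreover have "cylinder_sum x S = \<phi> S" if S: "S \<subseteq> A" for S
  proof -
    obtain n where n: "S = set_decode n"
      using S A finite_subset by (metis set_encode_inverse)
    let ?J = "{i. i < n \<and> set_decode i \<subseteq> set_decode n}"
    have J: "finite ?J" by (rule finite_subset [of _ "{..<n}"]) auto
    have "cylinder_sum x S = (\<Sum>i\<in>insert n ?J. x i)"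
      unfolding cylinder_sum_def n using J subset_decode_imp_le
      by (intro sum.mono_neutral_left) (auto simp: le_less)
    also have "\<dots> = (\<Sum>i\<in>insert n ?J. moebius \<phi> i)"
      using S n by (intro sum.cong) (auto simp: x_def)
    also have "\<dots> = \<phi> S"
      using J by (simp add: moebius.simps [of \<phi> n] n)
    finally show ?thesis .
  qed
  ultimately show ?thesis using that by blast
qed

section \<open>Expectations on finite Bernoulli cubes and the norm they define\<close>

definition bweight :: "(nat \<Rightarrow> real) \<Rightarrow> nat set \<Rightarrow> nat set \<Rightarrow> real" where
  "bweight r A S = (\<Prod>j\<in>A. if j \<in> S then 1 - r j else r j)"

definition bexp :: "(nat \<Rightarrow> real) \<Rightarrow> nat set \<Rightarrow> (nat set \<Rightarrow> real) \<Rightarrow> real" where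
  "bexp r A \<phi> = (\<Sum>S\<in>Pow A. bweight r A S * \<phi> S)"

definition bnorm :: "(nat \<Rightarrow> real) \<Rightarrow> (nat \<Rightarrow> real) \<Rightarrow> real" where
  "bnorm r x = bexp r (coords x) (\<lambda>S. \<bar>cylinder_sum x S\<bar>)"

text \<open>Points of \<open>topspace RV\<close> are undefined off \<open>Vset\<close>, hence the
  restriction.\<close>

definition bcode :: "(nat \<Rightarrow> real) \<Rightarrow> (nat \<Rightarrow> rat) \<Rightarrow> real" where
  "bcode r = (\<lambda>v\<in>Vset. bnorm r (rvec v))"

lemma bweight_total: "finite A \<Longrightarrow> (\<Sum>S\<in>Pow A. bweight r A S) = 1"
proof -
  assume A: "finite A"
  have "bweight r A S = (\<Prod>j\<in>S. 1 - r j) * (\<Prod>j\<in>A - S. r j)" if "S \<in> Pow A" for S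
  proof -
    have "A \<inter> {j. j \<in> S} = S" "A \<inter> - {j. j \<in> S} = A - S" using that by auto
    then show ?thesis
      unfolding bweight_def prod.If_cases [OF A] by simp
  qed
  then have "(\<Sum>S\<in>Pow A. bweight r A S) = (\<Prod>j\<in>A. (1 - r j) + r j)"
    unfolding prod_add [OF A] by (rule sum.cong [OF refl])
  then show ?thesis by simp
qed

lemma bexp_Fubini:
  assumes "finite A" "finite B" "A \<inter> B = {}"
  shows "bexp r (A \<union> B) \<phi> = (\<Sum>T\<in>Pow B. bweight r B T * bexp r A (\<lambda>S. \<phi> (S \<union> T)))"
proof -
  have w: "bweight r (A \<union> B) (S \<union> T) = bweight r A S * bweight r B T" if "S \<subseteq> A" "T \<subseteq> B" for S T
  proof -
    have "bweight r (A \<union> B) (S \<union> T) = bweight r A (S \<union> T) * bweight r B (S \<union> T)"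
      unfolding bweight_def using assms by (rule prod.union_disjoint)
    also have "bweight r A (S \<union> T) = bweight r A S"
      unfolding bweight_def using that assms by (intro prod.cong) auto
    also have "bweight r B (S \<union> T) = bweight r B T"
      unfolding bweight_def using that assms by (intro prod.cong) auto
    finally show ?thesis .
  qed
  have bij: "bij_betw (\<lambda>(T, S). S \<union> T) (Pow B \<times> Pow A) (Pow (A \<union> B))"
    by (rule bij_betw_byWitness [of _ "\<lambda>U. (U \<inter> B, U \<inter> A)"]) (use assms in auto)
  have "bexp r (A \<union> B) \<phi> = (\<Sum>(T, S)\<in>Pow B \<times> Pow A. bweight r (A \<union> B) (S \<union> T) * \<phi> (S \<union> T))"
    unfolding bexp_def sum.reindex_bij_betw [OF bij, symmetric] by (simp add: case_prod_unfold)
  also have "\<dots> = (\<Sum>(T, S)\<in>Pow B \<times> Pow A. bweight r B T * (bweight r A S * \<phi> (S \<union> T)))"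
    by (rule sum.cong) (auto simp: w)
  also have "\<dots> = (\<Sum>T\<in>Pow B. bweight r B T * bexp r A (\<lambda>S. \<phi> (S \<union> T)))"
    by (simp add: sum.cartesian_product [symmetric] bexp_def sum_distrib_left)
  finally show ?thesis .
qed

lemma bexp_cong: "(\<And>S. S \<subseteq> A \<Longrightarrow> \<phi> S = \<psi> S) \<Longrightarrow> bexp r A \<phi> = bexp r A \<psi>"
  unfolding bexp_def by (rule sum.cong) auto

lemma bexp_add: "bexp r A (\<lambda>S. \<phi> S + \<psi> S) = bexp r A \<phi> + bexp r A \<psi>"
  by (simp add: bexp_def distrib_left sum.distrib)

lemma bexp_scale: "bexp r A (\<lambda>S. c * \<phi> S) = c * bexp r A \<phi>"
  by (simp add: bexp_def sum_distrib_left algebra_simps)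

lemma bnorm_eq:
  assumes "x \<in> c00" "coords x \<subseteq> A" "finite A"
  shows "bnorm r x = bexp r A (\<lambda>S. \<bar>cylinder_sum x S\<bar>)"
proof -
  let ?C = "coords x"
  have "bexp r A (\<lambda>S. \<bar>cylinder_sum x S\<bar>) = bexp r (?C \<union> (A - ?C)) (\<lambda>S. \<bar>cylinder_sum x S\<bar>)"
    using assms by (simp add: Un_absorb1)
  also have "\<dots> = (\<Sum>T\<in>Pow (A - ?C). bweight r (A - ?C) T * bexp r ?C (\<lambda>S. \<bar>cylinder_sum x (S \<union> T)\<bar>))"
    using assms by (intro bexp_Fubini) auto
  also have "\<dots> = (\<Sum>T\<in>Pow (A - ?C). bweight r (A - ?C) T * bnorm r x)"
  proof (rule sum.cong)
    fix T assume T: "T \<in> Pow (A - ?C)"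
    have "bexp r ?C (\<lambda>S. \<bar>cylinder_sum x (S \<union> T)\<bar>) = bnorm r x"
      unfolding bnorm_def
    proof (rule bexp_cong)
      fix S assume "S \<subseteq> ?C"
      then have "(S \<union> T) \<inter> ?C = S \<inter> ?C" using T by auto
      then show "\<bar>cylinder_sum x (S \<union> T)\<bar> = \<bar>cylinder_sum x S\<bar>"
        by (metis cylinder_sum_Int order_refl)
    qed
    then show "bweight r (A - ?C) T * bexp r ?C (\<lambda>S. \<bar>cylinder_sum x (S \<union> T)\<bar>) = bweight r (A - ?C) T * bnorm r x"
      by simp
  qed simp
  also have "\<dots> = bnorm r x"
    using bweight_total [of "A - ?C" r] assms by (simp add: sum_distrib_right [symmetric])
  finally show ?thesis by simp
qed

text \<open>For fixed \<open>x\<close> the norm is a polynomial in finitely many of the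
  parameters.\<close>

lemma continuous_map_bnorm:
  assumes "x \<in> c00" "\<And>j. continuous_map Y euclideanreal (\<lambda>y. r y j)"
  shows "continuous_map Y euclideanreal (\<lambda>y. bnorm (r y) x)"
proof -
  have "continuous_map Y euclideanreal (\<lambda>y. bweight (r y) A S)" if "finite A" for A S
    unfolding bweight_def
  proof (rule continuous_map_prod [OF that])
    show "continuous_map Y euclideanreal (\<lambda>y. if j \<in> S then 1 - r y j else r y j)" for j
      using assms(2) by (cases "j \<in> S") (auto intro: continuous_intros)
  qed
  then show ?thesis
    unfolding bnorm_def bexp_def using assms(1)
    by (intro continuous_map_sum continuous_map_real_mult_right) auto
qed

lemma coords_scale: "coords (\<lambda>i. c * x i) \<subseteq> coords x"
  and coords_add: "coords (\<lambda>i. x i + y i) \<subseteq> coords x \<union> coords y"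
  and coords_diff: "coords (\<lambda>i. x i - y i) \<subseteq> coords x \<union> coords y"
  by (auto simp: coords_def) (metis add.right_neutral, metis diff_zero)

text \<open>\<open>r j\<close> is the probability that \<open>j\<close> is absent. Parameters
  strictly between 0 and 1 give every point of a finite cube positive weight, so the seminorm is a
  norm; \<open>r j \<ge> 1 / 2\<close> makes the empty set the heaviest point, which yields
  \<open>bweight_le\<close>.\<close>

locale bernoulli =
  fixes r :: "nat \<Rightarrow> real"
  assumes r_ge: "\<And>j. 1 / 2 \<le> r j" and r_less: "\<And>j. r j < 1"
begin

lemma r_pos: "0 < r j"
  using r_ge [of j] by simp

lemma one_minus_r_le: "1 - r j \<le> r j"
  using r_ge [of j] by simp

lemma bweight_pos: "0 < bweight r A S"
  unfolding bweight_def by (rule prod_pos) (use r_pos r_less in auto)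

lemma bweight_le: "bweight r A S \<le> (\<Prod>j\<in>A. r j)"
  unfolding bweight_def by (rule prod_mono) (auto simp: one_minus_r_le less_imp_le [OF r_pos] less_imp_le [OF r_less])

lemma bexp_mono: "(\<And>S. S \<subseteq> A \<Longrightarrow> \<phi> S \<le> \<psi> S) \<Longrightarrow> bexp r A \<phi> \<le> bexp r A \<psi>"
  unfolding bexp_def by (intro sum_mono mult_left_mono) (use bweight_pos in \<open>auto simp: less_imp_le\<close>)

lemma bexp_ge_atom:
  assumes "finite A" "\<And>S. S \<subseteq> A \<Longrightarrow> 0 \<le> \<phi> S"
  shows "(\<Prod>j\<in>A. r j) * \<phi> {} \<le> bexp r A \<phi>"
proof -
  have "bweight r A {} * \<phi> {} \<le> bexp r A \<phi>"
    unfolding bexp_def using assms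
    by (intro member_le_sum) (auto simp: bweight_pos less_imp_le)
  then show ?thesis by (simp add: bweight_def)
qed

sublocale c00_seminorm "bnorm r"
proof
  fix x y :: "nat \<Rightarrow> real" assume xy: "x \<in> c00" "y \<in> c00"
  let ?A = "coords x \<union> coords y"
  have "bnorm r (\<lambda>i. x i + y i) = bexp r ?A (\<lambda>S. \<bar>cylinder_sum (\<lambda>i. x i + y i) S\<bar>)"
    using xy coords_add by (intro bnorm_eq) auto
  also have "\<dots> \<le> bexp r ?A (\<lambda>S. \<bar>cylinder_sum x S\<bar> + \<bar>cylinder_sum y S\<bar>)"
    by (rule bexp_mono) (simp add: cylinder_sum_linear(2) [OF xy])
  also have "\<dots> = bnorm r x + bnorm r y"
    unfolding bexp_add using xy by (simp add: bnorm_eq [of x ?A] bnorm_eq [of y ?A])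
  finally show "bnorm r (\<lambda>i. x i + y i) \<le> bnorm r x + bnorm r y" .
next
  fix x :: "nat \<Rightarrow> real" and c assume x: "x \<in> c00"
  have "bnorm r (\<lambda>i. c * x i) = bexp r (coords x) (\<lambda>S. \<bar>cylinder_sum (\<lambda>i. c * x i) S\<bar>)"
    using x coords_scale by (intro bnorm_eq) auto
  then show "bnorm r (\<lambda>i. c * x i) = \<bar>c\<bar> * bnorm r x"
    by (simp add: cylinder_sum_linear(4) [OF x x] abs_mult bexp_scale bnorm_def)
qed

lemma bnorm_eq_0:
  assumes "x \<in> c00" "bnorm r x = 0"
  shows "x = (\<lambda>_. 0)"
proof (rule ccontr)
  assume "x \<noteq> (\<lambda>_. 0)"
  then obtain S where S: "S \<subseteq> coords x" "cylinder_sum x S \<noteq> 0"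
    using cylinder_sum_nonzero assms(1) by blast
  have "bweight r (coords x) S * \<bar>cylinder_sum x S\<bar> = 0"
    using assms S unfolding bnorm_def bexp_def
    by (subst (asm) sum_nonneg_eq_0_iff) (auto simp: bweight_pos less_imp_le)
  then show False using S bweight_pos [of "coords x" S] by simp
qed

lemma bcode_Pset: "bcode r \<in> Pset"
  unfolding Pset_def
proof (intro CollectI conjI ballI allI)
  show "bcode r \<in> topspace RV" by (simp add: RV_def bcode_def)
  fix x assume x: "x \<in> Vset"
  show "bcode r (\<lambda>i. x i + y i) \<le> bcode r x + bcode r y" if y: "y \<in> Vset" for y
  proof -
    have "rvec (\<lambda>i. x i + y i) = (\<lambda>i. rvec x i + rvec y i)"
      by (auto simp: rvec_def of_rat_add)
    then show ?thesis using x y add by (simp add: bcode_def)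
  qed
  show "bcode r (\<lambda>i. c * x i) = real_of_rat \<bar>c\<bar> * bcode r x" for c
  proof -
    have "rvec (\<lambda>i. c * x i) = (\<lambda>i. real_of_rat c * rvec x i)"
      by (auto simp: rvec_def of_rat_mult)
    then show ?thesis using x scale by (simp add: bcode_def)
  qed
qed

lemma mubar_bcode:
  assumes x: "x \<in> c00"
  shows "mubar (bcode r) x = bnorm r x"
proof (rule LIMSEQ_unique [OF mubar_qapprox [OF bcode_Pset x]])
  have "(\<lambda>k. bnorm r (rvec (qapprox x k))) \<longlonglongrightarrow> bnorm r x"
    by (rule tendsto_coordinates [of "{i. x i \<noteq> 0}"])
      (use x in \<open>auto simp: c00_def qapprox_eq_0 rvec_def qapprox_tendsto\<close>)
  then show "(\<lambda>k. bcode r (qapprox x k)) \<longlonglongrightarrow> bnorm r x"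
    using x by (simp add: bcode_def)
qed

lemma bcode_Bset: "bcode r \<in> Bset"
proof -
  have "Xinfdim (bcode r)"
    unfolding Xinfdim_def
  proof (intro allI exI conjI impI)
    fix n :: nat
    let ?s = "\<lambda>j (m::nat) i. if i = j then 1 else 0 :: real"
    show "?s j \<in> Xpts (bcode r)" for j
      using Xpts_const [OF bcode_Pset, of "\<lambda>i. if i = j then 1 else 0"] c00_I [of "{j}" "\<lambda>i. if i = j then 1 else 0"] by simp
    fix c :: "nat \<Rightarrow> real" assume "\<exists>j<n. c j \<noteq> 0"
    then obtain j where j: "j < n" "c j \<noteq> 0" by blast
    define u where "u = (\<lambda>i. \<Sum>j<n. c j * (if i = j then 1 else 0))"
    have u_eq: "u i = (if i < n then c i else 0)" for i
      by (simp add: u_def if_distrib [of "\<lambda>d. _ * d"] cong: if_cong)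
    have u: "u \<in> c00"
      by (rule c00_I [of "{..<n}"]) (simp_all add: u_eq)
    have "u j \<noteq> 0" using j by (simp add: u_eq)
    then have "u \<noteq> (\<lambda>_. 0)" by auto
    note u = u this
    then have "bnorm r u \<noteq> 0"
      using bnorm_eq_0 by blast
    then show "Xnorm (bcode r) (\<lambda>m i. \<Sum>j<n. c j * ?s j m i) \<noteq> 0"
      using u mubar_bcode [OF u(1)] Xnorm_const [OF bcode_Pset, of u] by (simp add: u_def)
  qed
  then show ?thesis
    using bcode_Pset bnorm_eq_0 by (simp add: Bset_def Pinf_def mubar_bcode)
qed

text \<open>Concentrating \<open>z\<close> on the cylinder \<open>T\<close> of small measure makes it almost disjoint from \<open>x\<close>;
  averaging over \<open>T\<close> gives back \<open>z\<close>.\<close>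
lemma Daugavet_bcode:
  assumes lim: "(\<lambda>M. \<Prod>j<M. r j) \<longlonglongrightarrow> 0"
  shows "Daugavet (bcode r)"
proof (rule Daugavet_if_on_c00 [OF bcode_Pset])
  fix f x z and e :: real
  assume f: "c00_linear f"
    and x: "x \<in> c00" "mubar (bcode r) x > 1" and z: "z \<in> c00" "mubar (bcode r) z < 1" "mubar (bcode r) z > 1 - e"
  note lin = c00_linearD [OF f]
  have Nx: "bnorm r x > 1" and Nz: "bnorm r z < 1" "bnorm r z > 1 - e"
    using x z by (simp_all add: mubar_bcode)
  obtain L where L: "coords x \<union> coords z \<subseteq> {..<L}"
    using finite_nat_bounded [of "coords x \<union> coords z"] x z by auto
  \<comment> \<open>Half the slack in the sum of the two norms exceeding \<open>2 - e\<close>,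
    relative to the norm of \<open>x\<close>: an overlap below \<open>\<delta>\<close> times that
    norm costs at most this slack.\<close>
  define \<delta> where "\<delta> = (bnorm r x + bnorm r z - 2 + e) / (2 * bnorm r x)"
  have "\<delta> > 0" using Nx Nz by (simp add: \<delta>_def)
  \<comment> \<open>The cells must be cut out by fresh coordinates, on which neither
    \<open>x\<close> nor \<open>z\<close> depends. Dividing by the product over the first
    \<open>L\<close> coordinates leaves the product over the fresh block, still small since the
    whole product tends to 0.\<close>
  define PL where "PL = (\<Prod>j<L. r j)"
  have "PL > 0" unfolding PL_def by (rule prod_pos) (simp add: r_pos)
  have "eventually (\<lambda>M. (\<Prod>j<M. r j) < \<delta> * PL) sequentially"
    using lim \<open>\<delta> > 0\<close> \<open>PL > 0\<close> by (intro order_tendstoD) auto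
  then have "eventually (\<lambda>M. (\<Prod>j<M. r j) < \<delta> * PL \<and> M \<ge> L) sequentially"
    using eventually_ge_at_top [of L] by eventually_elim auto
  then obtain M where M: "(\<Prod>j<M. r j) < \<delta> * PL" "M \<ge> L"
    using eventually_happens' [OF sequentially_bot] by blast
  let ?A = "{..<L}" and ?B = "{L..<M}"
  let ?w = "bweight r ?B"
  have AB: "finite ?A" "finite ?B" "?A \<inter> ?B = {}" "?A \<union> ?B = {..<M}" using M by auto
  have "(\<Prod>j<M. r j) = PL * (\<Prod>j\<in>?B. r j)"
    unfolding PL_def AB(4) [symmetric] using AB by (intro prod.union_disjoint)
  then have small: "(\<Prod>j\<in>?B. r j) < \<delta>"
    using M(1) \<open>PL > 0\<close> by (simp add: mult.commute)
  \<comment> \<open>\<open>y T\<close> is \<open>z\<close> restricted to the cell where the fresh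
    coordinates agree with \<open>T\<close>, divided by the weight of this cell.\<close>
  have "\<exists>y. y \<in> c00 \<and> coords y \<subseteq> ?A \<union> ?B \<and>
      (\<forall>S\<subseteq>?A \<union> ?B. cylinder_sum y S = cylinder_sum z (S \<inter> ?A) * of_bool (S \<inter> ?B = T) / ?w T)" for T
    by (rule cylinder_sum_surj [of "?A \<union> ?B" "\<lambda>S. cylinder_sum z (S \<inter> ?A) * of_bool (S \<inter> ?B = T) / ?w T"])
      (simp, blast)
  then obtain y where y: "\<And>T. y T \<in> c00" "\<And>T. coords (y T) \<subseteq> ?A \<union> ?B"
      "\<And>T S. S \<subseteq> ?A \<union> ?B \<Longrightarrow> cylinder_sum (y T) S = cylinder_sum z (S \<inter> ?A) * of_bool (S \<inter> ?B = T) / ?w T"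
    by metis
  \<comment> \<open>Independence: a function of the old coordinates has on each cell its share of
    the norm.\<close>
  have conc: "bexp r (?A \<union> ?B) (\<lambda>S. \<bar>cylinder_sum v (S \<inter> ?A)\<bar> * of_bool (S \<inter> ?B = T)) = ?w T * bnorm r v"
    if v: "v \<in> c00" "coords v \<subseteq> ?A" and T: "T \<subseteq> ?B" for v T
  proof -
    have "bexp r (?A \<union> ?B) (\<lambda>S. \<bar>cylinder_sum v (S \<inter> ?A)\<bar> * of_bool (S \<inter> ?B = T)) =
      (\<Sum>U\<in>Pow ?B. ?w U * bexp r ?A (\<lambda>S. \<bar>cylinder_sum v ((S \<union> U) \<inter> ?A)\<bar> * of_bool ((S \<union> U) \<inter> ?B = T)))"
      by (rule bexp_Fubini) (use AB in auto)
    also have "\<dots> = (\<Sum>U\<in>Pow ?B. if U = T then ?w T * bnorm r v else 0)"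
    proof (rule sum.cong [OF refl])
      fix U assume U: "U \<in> Pow ?B"
      have "(S \<union> U) \<inter> ?A = S" "(S \<union> U) \<inter> ?B = U" if "S \<subseteq> ?A" for S
        using U that AB(3) by auto
      then have "bexp r ?A (\<lambda>S. \<bar>cylinder_sum v ((S \<union> U) \<inter> ?A)\<bar> * of_bool ((S \<union> U) \<inter> ?B = T))
          = bexp r ?A (\<lambda>S. of_bool (U = T) * \<bar>cylinder_sum v S\<bar>)"
        by (intro bexp_cong) simp
      also have "\<dots> = of_bool (U = T) * bnorm r v"
        unfolding bexp_scale using v by (simp add: bnorm_eq [of v ?A])
      finally show "?w U * bexp r ?A (\<lambda>S. \<bar>cylinder_sum v ((S \<union> U) \<inter> ?A)\<bar> * of_bool ((S \<union> U) \<inter> ?B = T))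
          = (if U = T then ?w T * bnorm r v else 0)"
        by simp
    qed
    also have "\<dots> = ?w T * bnorm r v"
      using T by simp
    finally show ?thesis .
  qed
  have Ny: "bnorm r (y T) = bnorm r z" if T: "T \<subseteq> ?B" for T
  proof -
    have "bnorm r (y T) = bexp r (?A \<union> ?B) (\<lambda>S. \<bar>cylinder_sum (y T) S\<bar>)"
      by (rule bnorm_eq) (use y in auto)
    also have "\<dots> = bexp r (?A \<union> ?B) (\<lambda>S. inverse (?w T) * (\<bar>cylinder_sum z (S \<inter> ?A)\<bar> * of_bool (S \<inter> ?B = T)))"
      by (rule bexp_cong) (use bweight_pos [of ?B T] in \<open>simp add: y(3) abs_mult field_simps\<close>)
    also have "\<dots> = bnorm r z"
      unfolding bexp_scale using conc [OF z(1) _ T] L bweight_pos [of ?B T] by simp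
    finally show ?thesis .
  qed
  have far: "bnorm r (\<lambda>i. x i - y T i) > 2 - e" if T: "T \<subseteq> ?B" for T
  proof -
    have cx: "coords x \<subseteq> ?A" using L by auto
    let ?d = "\<lambda>S. \<bar>cylinder_sum x (S \<inter> ?A)\<bar> * of_bool (S \<inter> ?B = T)"
    have "bnorm r x + bnorm r (y T) =
        bexp r (?A \<union> ?B) (\<lambda>S. \<bar>cylinder_sum x S\<bar> + \<bar>cylinder_sum (y T) S\<bar>)"
      unfolding bexp_add using x y cx by (subst (1 2) bnorm_eq [where A = "?A \<union> ?B"]) auto
    \<comment> \<open>Off the cell \<open>y T\<close> vanishes and equality holds without the
      correction; on the cell the triangle inequality costs twice the absolute value of
      \<open>x\<close>.\<close>
    also have "\<dots> \<le> bexp r (?A \<union> ?B) (\<lambda>S. \<bar>cylinder_sum (\<lambda>i. x i - y T i) S\<bar> + 2 * ?d S)"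
    proof (rule bexp_mono)
      fix S assume S: "S \<subseteq> ?A \<union> ?B"
      show "\<bar>cylinder_sum x S\<bar> + \<bar>cylinder_sum (y T) S\<bar> \<le> \<bar>cylinder_sum (\<lambda>i. x i - y T i) S\<bar> + 2 * ?d S"
        unfolding cylinder_sum_linear(3) [OF x(1) y(1)]
        using cylinder_sum_Int [OF cx, of S] y(3) [OF S, of T] by (cases "S \<inter> ?B = T") auto
    qed
    also have "\<dots> = bnorm r (\<lambda>i. x i - y T i) + 2 * (?w T * bnorm r x)"
    proof -
      have "coords (\<lambda>i. x i - y T i) \<subseteq> ?A \<union> ?B"
        using coords_diff [of x "y T"] cx y(2) [of T] by blast
      then have "bnorm r (\<lambda>i. x i - y T i) = bexp r (?A \<union> ?B) (\<lambda>S. \<bar>cylinder_sum (\<lambda>i. x i - y T i) S\<bar>)"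
        using x y by (intro bnorm_eq) auto
      then show ?thesis
        unfolding bexp_add bexp_scale conc [OF x(1) cx T] by simp
    qed
    finally have "bnorm r (\<lambda>i. x i - y T i) \<ge> bnorm r x + bnorm r z - ?w T * (2 * bnorm r x)"
      using Ny [OF T] by (simp add: algebra_simps)
    moreover have "?w T * (2 * bnorm r x) < \<delta> * (2 * bnorm r x)"
      using bweight_le [of ?B T] small Nx by (intro mult_strict_right_mono) auto
    moreover have "\<delta> * (2 * bnorm r x) = bnorm r x + bnorm r z - 2 + e"
      using Nx by (simp add: \<delta>_def)
    ultimately show ?thesis by linarith
  qed
  \<comment> \<open>By linear independence it suffices to compare values. At a point
    \<open>S\<close> only the cell \<open>T = S \<inter> ?B\<close> contributes, and the weight
    cancels.\<close>
  have z_eq: "z = (\<lambda>i. \<Sum>T\<in>Pow ?B. ?w T * y T i)" (is "z = ?v")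
  proof (rule ccontr)
    assume "z \<noteq> ?v"
    have v: "?v \<in> c00" by (rule c00_sum) (simp add: y)
    have "(\<lambda>i. z i - ?v i) \<noteq> (\<lambda>_. 0)"
      using \<open>z \<noteq> ?v\<close> by (metis eq_iff_diff_eq_0 ext)
    then obtain S where S: "cylinder_sum (\<lambda>i. z i - ?v i) S \<noteq> 0"
      using cylinder_sum_nonzero [OF c00_diff [OF z(1) v]] by blast
    let ?S = "S \<inter> (?A \<union> ?B)"
    have "cylinder_sum ?v S = (\<Sum>T\<in>Pow ?B. ?w T * cylinder_sum (y T) S)"
      by (rule c00_linear_sum [OF c00_linear_cylinder_sum]) (rule y)
    also have "\<dots> = (\<Sum>T\<in>Pow ?B. if T = S \<inter> ?B then cylinder_sum z S else 0)"
    proof (rule sum.cong [OF refl])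
      fix T
      have "cylinder_sum (y T) S = cylinder_sum (y T) ?S"
        using cylinder_sum_Int [OF y(2)] by simp
      also have "\<dots> = cylinder_sum z (S \<inter> ?A) * of_bool (S \<inter> ?B = T) / ?w T"
      proof -
        have "?S \<inter> ?A = S \<inter> ?A" "?S \<inter> ?B = S \<inter> ?B" by auto
        then show ?thesis using y(3) [of ?S T] by simp
      qed
      also have "cylinder_sum z (S \<inter> ?A) = cylinder_sum z S"
        using L by (intro cylinder_sum_Int) auto
      finally show "?w T * cylinder_sum (y T) S = (if T = S \<inter> ?B then cylinder_sum z S else 0)"
        using bweight_pos [of ?B T] by auto
    qed
    also have "\<dots> = cylinder_sum z S" by simp
    finally show False using S cylinder_sum_linear(3) [OF z(1) v] by simp
  qed
  have "\<exists>T\<in>Pow ?B. f (y T) \<ge> f z"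
  proof (rule ccontr)
    assume "\<not> ?thesis"
    then have "(\<Sum>T\<in>Pow ?B. ?w T * f (y T)) < (\<Sum>T\<in>Pow ?B. ?w T * f z)"
      using bweight_pos by (intro sum_strict_mono mult_strict_left_mono) (auto simp: not_le)
    also have "\<dots> = f z"
      using bweight_total [of ?B r] by (simp add: sum_distrib_right [symmetric])
    also have "\<dots> = (\<Sum>T\<in>Pow ?B. ?w T * f (y T))"
      by (subst z_eq, rule c00_linear_sum [OF f]) (rule y)
    finally show False by simp
  qed
  then obtain T where T: "T \<subseteq> ?B" "f (y T) \<ge> f z" by blast
  assume "e > 0"
  with T show "\<exists>y\<in>c00. mubar (bcode r) y < 1 \<and> f y > f z - e \<and> mubar (bcode r) (\<lambda>i. x i - y i) > 2 - e"
    using y(1) Ny far Nz x by (intro bexI [of _ "y T"]) (auto simp: mubar_bcode)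
qed

text \<open>If the measure has an atom at the empty set, the evaluation there is a norm-one functional
  exposing a point of the unit ball by small slices.\<close>
lemma not_Daugavet_bcode:
  assumes "c > 0" and c: "\<And>M. c \<le> (\<Prod>j<M. r j)" and M0: "3 / 4 * (\<Prod>j<M0. r j) < c"
  shows "\<not> Daugavet (bcode r)"
proof
  assume D: "Daugavet (bcode r)"
  \<comment> \<open>By \<open>cylinder_sum_empty\<close>, \<open>v 0\<close> is the value at the
    empty set; the factor \<open>c\<close>, a lower bound for its mass, puts the functional below
    the norm.\<close>
  define f where "f v = c * v 0" for v :: "nat \<Rightarrow> real"
  have f: "c00_linear f"
    by (simp add: c00_linear_def f_def algebra_simps)
  \<comment> \<open>Two functions positive at the atom overlap there, so the norm of their
    difference falls short of the sum of the norms. The integrand of the shortfall is nonnegative,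
    and at the atom it is twice the smaller value.\<close>
  have atom: "2 * min (f v) (f w) \<le> bnorm r v + bnorm r w - bnorm r (\<lambda>i. v i - w i)"
    if vw: "v \<in> c00" "w \<in> c00" "f v > 0" "f w > 0" for v w
  proof -
    obtain M where M: "coords v \<union> coords w \<subseteq> {..<M}"
      using finite_nat_bounded [of "coords v \<union> coords w"] vw by auto
    let ?g = "\<lambda>S. \<bar>cylinder_sum v S\<bar> + \<bar>cylinder_sum w S\<bar> + (-1) * \<bar>cylinder_sum (\<lambda>i. v i - w i) S\<bar>"
    have pos: "v 0 > 0" "w 0 > 0" using vw \<open>c > 0\<close> by (simp_all add: f_def zero_less_mult_iff)
    have "2 * min (f v) (f w) = c * (2 * min (v 0) (w 0))"
      using \<open>c > 0\<close> by (simp add: f_def min_def)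
    also have "\<dots> \<le> (\<Prod>j<M. r j) * (2 * min (v 0) (w 0))"
      using c [of M] pos by (intro mult_right_mono) auto
    also have "\<dots> = (\<Prod>j<M. r j) * ?g {}"
      unfolding cylinder_sum_empty using pos by (intro arg_cong2 [of _ _ _ _ "(*)"]) auto
    also have "(\<Prod>j<M. r j) * ?g {} \<le> bexp r {..<M} ?g"
      by (rule bexp_ge_atom) (auto simp: cylinder_sum_linear(3) [OF vw(1,2)])
    also have "\<dots> = bnorm r v + bnorm r w - bnorm r (\<lambda>i. v i - w i)"
    proof -
      have "coords (\<lambda>i. v i - w i) \<subseteq> {..<M}" using coords_diff [of v w] M by blast
      then have "bnorm r v = bexp r {..<M} (\<lambda>S. \<bar>cylinder_sum v S\<bar>)"
        "bnorm r w = bexp r {..<M} (\<lambda>S. \<bar>cylinder_sum w S\<bar>)"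
        "bnorm r (\<lambda>i. v i - w i) = bexp r {..<M} (\<lambda>S. \<bar>cylinder_sum (\<lambda>i. v i - w i) S\<bar>)"
        using M vw by (intro bnorm_eq; simp)+
      then show ?thesis unfolding bexp_add bexp_scale by simp
    qed
    finally show ?thesis .
  qed
  \<comment> \<open>For positive \<open>f v\<close> this is \<open>atom\<close> with both functions
    equal.\<close>
  have fle: "f v \<le> mubar (bcode r) v" if v: "v \<in> c00" for v
  proof (cases "f v > 0")
    case True
    then show ?thesis using atom [OF v v] v by (simp add: mubar_bcode)
  next
    case False
    then show ?thesis using nonneg [OF v] v by (simp add: mubar_bcode)
  qed
  let ?A = "{..<M0}"
  define P where "P = (\<Prod>j<M0. r j)"
  have "P > 0" unfolding P_def by (rule prod_pos) (simp add: r_pos)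
  \<comment> \<open>The normalised indicator of the cell around the atom. By the choice of
    \<open>M0\<close> the atom carries more than 3/4 of the mass of the cell.\<close>
  obtain u where u: "u \<in> c00" "coords u \<subseteq> ?A" "\<And>S. S \<subseteq> ?A \<Longrightarrow> cylinder_sum u S = of_bool (S = {}) / P"
    using cylinder_sum_surj [of ?A "\<lambda>S. of_bool (S = {}) / P"] by auto
  have "bnorm r u = (\<Sum>S\<in>Pow ?A. if S = {} then 1 else 0)"
    unfolding bnorm_eq [OF u(1,2) finite_lessThan] bexp_def
  proof (rule sum.cong [OF refl])
    fix S assume "S \<in> Pow ?A"
    then show "bweight r ?A S * \<bar>cylinder_sum u S\<bar> = (if S = {} then 1 else 0)"
      using u(3) [of S] \<open>P > 0\<close> by (auto simp: bweight_def P_def [symmetric])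
  qed
  then have Nu: "bnorm r u = 1" by simp
  have "u 0 = 1 / P" using u(3) [of "{}"] by (simp add: cylinder_sum_empty)
  then have fu: "f u > 3 / 4"
    using M0 \<open>P > 0\<close> by (simp add: f_def P_def [symmetric] pos_less_divide_eq)
  note lin = c00_linearD [OF f u(1) u(1)]
  \<comment> \<open>The factors place the norms on the two sides of 1. With tolerance 1/4,
    \<open>f y > 9/16 - 1/4 = 5/16\<close>, so \<open>atom\<close> bounds the distance of
    \<open>x\<close> and \<open>y\<close> by \<open>5/4 + 1 - 5/8 = 13/8\<close>, less than
    \<open>2 - 1/4\<close>.\<close>
  define x where "x = (\<lambda>i. 5 / 4 * u i)"
  define z where "z = (\<lambda>i. 3 / 4 * u i)"
  have xz: "x \<in> c00" "z \<in> c00"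
    unfolding x_def z_def using u(1) by (rule c00_scale)+
  have Nxz: "bnorm r x = 5 / 4" "bnorm r z = 3 / 4"
    unfolding x_def z_def scale [OF u(1)] using Nu by simp_all
  have nz: "f u \<noteq> 0" using fu by simp
  obtain y where y: "y \<in> c00" "mubar (bcode r) y < 1" "f y > f z - 1 / 4"
    "mubar (bcode r) (\<lambda>i. x i - y i) > 2 - 1 / 4"
    by (rule Daugavet_on_c00 [OF bcode_Pset D f fle u(1) nz xz(1) _ xz(2), of "1 / 4"])
      (simp_all add: mubar_bcode xz Nxz)
  have "bnorm r y < 1" "bnorm r (\<lambda>i. x i - y i) > 2 - 1 / 4"
    using y xz by (simp_all add: mubar_bcode)
  moreover have "f z > 9 / 16" "f x > 15 / 16"
    unfolding x_def z_def lin(4) using fu by simp_all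
  moreover from this have "min (f x) (f y) > 5 / 16" "f x > 0" "f y > 0"
    using y(3) by auto
  ultimately show False
    using atom [OF xz(1) y(1)] Nxz by linarith
qed

lemma prod_r_antimono: "m \<le> n \<Longrightarrow> (\<Prod>j<n. r j) \<le> (\<Prod>j<m. r j)"
proof (induction n rule: dec_induct)
  case (step n)
  have "(\<Prod>j<n. r j) \<ge> 0" by (rule prod_nonneg) (simp add: r_pos less_imp_le)
  then have "(\<Prod>j<Suc n. r j) \<le> (\<Prod>j<n. r j)"
    using r_less [of n] by (simp add: mult_left_le less_imp_le)
  with step show ?case by linarith
qed simp

text \<open>The partial products decrease. A positive limit \<open>c\<close> is the mass of an atom,
  and the partial products eventually stay below \<open>4 / 3 * c\<close>, which is what the
  negative case asks for.\<close>

lemma Daugavet_bcode_iff: "Daugavet (bcode r) \<longleftrightarrow> (\<lambda>M. \<Prod>j<M. r j) \<longlonglongrightarrow> 0"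
proof
  assume D: "Daugavet (bcode r)"
  let ?P = "\<lambda>M. \<Prod>j<M. r j"
  have nn: "0 \<le> ?P M" for M
    by (rule prod_nonneg) (simp add: r_pos less_imp_le)
  have "decseq ?P" using prod_r_antimono by (simp add: decseq_def)
  then obtain c where c: "?P \<longlonglongrightarrow> c" "\<And>M. c \<le> ?P M"
    using decseq_convergent [of ?P 0] nn by blast
  have "c \<ge> 0" using LIMSEQ_le_const [OF c(1)] nn by blast
  moreover have "\<not> c > 0"
  proof
    assume "c > 0"
    then have "eventually (\<lambda>M. ?P M < 4 / 3 * c) sequentially"
      by (intro order_tendstoD [OF c(1)]) auto
    then obtain M0 where "?P M0 < 4 / 3 * c"
      using eventually_happens' [OF sequentially_bot] by blast
    then show False
      using not_Daugavet_bcode [OF \<open>c > 0\<close> c(2), of M0] D by simp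
  qed
  ultimately show "?P \<longlonglongrightarrow> 0" using c(1) by simp
qed (rule Daugavet_bcode)

end

section \<open>Reduction of arbitrary countable intersections of open sets\<close>

text \<open>The distance to the complement; the constant 1 replaces it when the complement is empty
  and the infimum has no meaning.\<close>

lemma open_support_function:
  assumes "metrizable_space Y" "openin Y U"
  obtains h where "continuous_map Y euclideanreal h" "\<And>y. 0 \<le> h y"
    "\<And>y. y \<in> topspace Y \<Longrightarrow> 0 < h y \<longleftrightarrow> y \<in> U"
proof -
  obtain M d where "Metric_space M d" and Y: "Y = Metric_space.mtopology M d"
    using assms(1) by (auto simp: metrizable_space_def)
  interpret Metric_space M d by fact
  show ?thesis
  proof (cases "M \<subseteq> U")
    case True
    then show ?thesis
      by (intro that [of "\<lambda>_. 1"]) (auto simp: Y)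
  next
    case False
    then have ne: "M - U \<noteq> {}" by blast
    define h where "h y = (INF u\<in>M - U. d y u)" for y
    have bdd: "bdd_below (d y ` (M - U))" for y
      by (meson bdd_belowI2 nonneg)
    have nn: "0 \<le> h y" for y
      unfolding h_def using ne by (intro cINF_greatest) auto
    have le: "h x \<le> h y + d x y" if "x \<in> M" "y \<in> M" for x y
    proof -
      have "h x - d x y \<le> h y"
        unfolding h_def [of y]
      proof (rule cINF_greatest [OF ne])
        fix u assume u: "u \<in> M - U"
        then have "h x \<le> d x u"
          unfolding h_def using bdd by (intro cINF_lower)
        also have "\<dots> \<le> d x y + d y u"
          using u that by (intro triangle) auto
        finally show "h x - d x y \<le> d y u" by simp
      qed
      then show ?thesis by simp
    qed
    then have "dist (h x) (h y) \<le> d x y" if "x \<in> M" "y \<in> M" for x y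
      using le [OF that] le [OF that(2,1)] commute [of y x] by (simp add: dist_real_def abs_le_iff)
    then have "Lipschitz_continuous_map Self euclidean_metric h"
      unfolding Lipschitz_continuous_map_def by (force intro!: exI [where x=1])
    then have "continuous_map Y euclideanreal h"
      using Lipschitz_continuous_imp_continuous_map [of Self euclidean_metric h] by (simp add: Y mtopology_of_def)
    moreover have "0 < h y \<longleftrightarrow> y \<in> U" if y: "y \<in> topspace Y" for y
    proof
      assume "0 < h y"
      show "y \<in> U"
      proof (rule ccontr)
        assume "y \<notin> U"
        then have "h y \<le> d y y"
          unfolding h_def using bdd y by (intro cINF_lower) (auto simp: Y)
        then show False using \<open>0 < h y\<close> y by (simp add: Y)
      qed
    next
      assume "y \<in> U"
      then obtain \<epsilon> where \<epsilon>: "\<epsilon> > 0" "mball y \<epsilon> \<subseteq> U"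
        using assms(2) unfolding Y openin_mtopology by blast
      have "\<epsilon> \<le> h y"
        unfolding h_def
      proof (rule cINF_greatest [OF ne])
        fix u assume "u \<in> M - U"
        then show "\<epsilon> \<le> d y u" using \<epsilon> y by (force simp: Y not_less [symmetric])
      qed
      then show "0 < h y" using \<epsilon> by simp
    qed
    ultimately show ?thesis using that nn by blast
  qed
qed

text \<open>Differences of a telescoping series: for \<open>t > 0\<close> the sum over all
  \<open>k\<close> is 1, however small \<open>t\<close> is, and for \<open>t = 0\<close> it is 0.
  Continuous nonnegative terms thus add up to the jump function.\<close>

definition ramp :: "nat \<Rightarrow> real \<Rightarrow> real" where
  "ramp k t = min 1 (real (Suc k) * t) - min 1 (real k * t)"

lemma ramp_bounds: "0 \<le> t \<Longrightarrow> 0 \<le> ramp k t" "0 \<le> t \<Longrightarrow> ramp k t \<le> 1"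
  by (auto simp: ramp_def min_def algebra_simps) (smt (verit) mult_nonneg_nonneg of_nat_0_le_iff)+

lemma sum_ramp: "(\<Sum>k<K. ramp k t) = min 1 (real K * t)"
  by (induction K) (auto simp: ramp_def)

lemma prod_exp_minus_tendsto_0_iff:
  fixes p :: "nat \<Rightarrow> real"
  assumes "\<And>j. 0 \<le> p j"
  shows "(\<lambda>M. \<Prod>j<M. exp (- p j)) \<longlonglongrightarrow> 0 \<longleftrightarrow> (\<forall>C. \<exists>M. C \<le> (\<Sum>j<M. p j))"
proof
  assume lim: "(\<lambda>M. \<Prod>j<M. exp (- p j)) \<longlonglongrightarrow> 0"
  show "\<forall>C. \<exists>M. C \<le> (\<Sum>j<M. p j)"
  proof
    fix C :: real
    have "eventually (\<lambda>M. (\<Prod>j<M. exp (- p j)) < exp (- C)) sequentially"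
      using lim by (rule order_tendstoD) simp
    then obtain M where "(\<Prod>j<M. exp (- p j)) < exp (- C)"
      using eventually_happens' [OF sequentially_bot] by blast
    then have "exp (- (\<Sum>j<M. p j)) < exp (- C)"
      by (simp add: exp_sum sum_negf [symmetric])
    then show "\<exists>M. C \<le> (\<Sum>j<M. p j)" by (auto intro: exI [of _ M])
  qed
next
  assume H: "\<forall>C. \<exists>M. C \<le> (\<Sum>j<M. p j)"
  show "(\<lambda>M. \<Prod>j<M. exp (- p j)) \<longlonglongrightarrow> 0"
  proof (rule LIMSEQ_I)
    fix e :: real assume "e > 0"
    from H obtain M where M: "1 - ln e \<le> (\<Sum>j<M. p j)" by blast
    have "norm ((\<Prod>j<n. exp (- p j)) - 0) < e" if "n \<ge> M" for n
    proof -
      have "(\<Sum>j<M. p j) \<le> (\<Sum>j<n. p j)"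
        using that assms by (intro sum_mono2) auto
      then have "- (\<Sum>j<n. p j) < ln e" using M by linarith
      then have "exp (- (\<Sum>j<n. p j)) < e"
        using \<open>e > 0\<close> by (metis exp_less_cancel_iff exp_ln)
      then show ?thesis
        by (simp add: exp_sum sum_negf [symmetric] abs_prod)
    qed
    then show "\<exists>M. \<forall>n\<ge>M. norm ((\<Prod>j<n. exp (- p j)) - 0) < e" by blast
  qed
qed

text \<open>The index \<open>j\<close> codes a pair \<open>(n, k)\<close>, and row \<open>n\<close>
  sums to 1 or to 0 according to whether \<open>t n\<close> is positive. By \<open>mono\<close> a
  single zero row kills all later ones, leaving a finite total; otherwise infinitely many rows
  contribute 1 each.\<close>

lemma unbounded_ramp_sums_iff:
  fixes t :: "nat \<Rightarrow> real"
  assumes t: "\<And>n. 0 \<le> t n" and mono: "\<And>m n. m \<le> n \<Longrightarrow> t m = 0 \<Longrightarrow> t n = 0"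
  defines "p \<equiv> \<lambda>j. (ramp (snd (prod_decode j)) (t (fst (prod_decode j))) + (1 / 2) ^ j) / 4"
  shows "(\<forall>C. \<exists>M. C \<le> (\<Sum>j<M. p j)) \<longleftrightarrow> (\<forall>n. t n > 0)"
proof -
  define q where "q j = ramp (snd (prod_decode j)) (t (fst (prod_decode j)))" for j
  have q: "0 \<le> q j" for j by (simp add: q_def ramp_bounds t)
  have p: "p j = q j / 4 + (1 / 2) ^ j / 4" for j by (simp add: p_def q_def add_divide_distrib)
  have q_sum: "(\<Sum>j\<in>prod_encode ` Sigma {..<N} (\<lambda>n. {..<K n}). q j) = (\<Sum>n<N. min 1 (real (K n) * t n))" for N K
  proof -
    have "(\<Sum>j\<in>prod_encode ` Sigma {..<N} (\<lambda>n. {..<K n}). q j) = (\<Sum>(n, k)\<in>Sigma {..<N} (\<lambda>n. {..<K n}). ramp k (t n))"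
      by (subst sum.reindex) (auto simp: inj_prod_encode q_def case_prod_unfold intro: inj_on_subset)
    also have "\<dots> = (\<Sum>n<N. \<Sum>k<K n. ramp k (t n))"
      by (subst sum.Sigma) auto
    finally show ?thesis by (simp add: sum_ramp)
  qed
  show ?thesis
  proof
    assume pos: "\<forall>n. t n > 0"
    show "\<forall>C. \<exists>M. C \<le> (\<Sum>j<M. p j)"
    proof
      fix C :: real
      obtain N :: nat where N: "4 * C \<le> real N" using real_arch_simple by blast
      have "\<exists>K::nat. 1 \<le> real K * t n" for n
        using pos reals_Archimedean3 [of "t n"] by (meson less_imp_le)
      then obtain K :: "nat \<Rightarrow> nat" where K: "\<And>n. 1 \<le> real (K n) * t n" by metis
      \<comment> \<open>The first \<open>K n\<close> entries of row \<open>n\<close> already sum to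
        1, so finitely many entries reach any target.\<close>
      let ?J = "prod_encode ` Sigma {..<N} (\<lambda>n. {..<K n})"
      have "finite ?J" by auto
      then obtain M where M: "?J \<subseteq> {..<M}" using finite_nat_bounded by blast
      have "real N = (\<Sum>j\<in>?J. q j)"
        unfolding q_sum using K by (simp add: min_def)
      also have "\<dots> \<le> (\<Sum>j<M. q j)"
        using M q by (intro sum_mono2) auto
      also have "\<dots> \<le> (\<Sum>j<M. 4 * p j)"
        by (rule sum_mono) (simp add: p)
      finally have "C \<le> (\<Sum>j<M. p j)" using N by (simp add: sum_distrib_left [symmetric])
      then show "\<exists>M. C \<le> (\<Sum>j<M. p j)" by blast
    qed
  next
    assume H: "\<forall>C. \<exists>M. C \<le> (\<Sum>j<M. p j)"
    show "\<forall>n. t n > 0"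
    proof (rule ccontr)
      assume "\<not> ?thesis"
      then obtain n0 where "t n0 = 0" using t by (metis less_eq_real_def)
      then have z: "t n = 0" if "n \<ge> n0" for n using mono that by blast
      \<comment> \<open>At most \<open>n0\<close> live rows contribute at most 1 each, and the
        geometric errors at most 2.\<close>
      have bound: "(\<Sum>j<M. p j) \<le> (real n0 + 2) / 4" for M
      proof -
        have "{..<M} \<subseteq> prod_encode ` ({..<M} \<times> {..<M})"
        proof
          fix j assume "j \<in> {..<M}"
          obtain a b where ab: "j = prod_encode (a, b)" by (metis prod_decode_inverse surj_pair)
          then have "a \<le> j" "b \<le> j" by (simp_all add: le_prod_encode_1 le_prod_encode_2)
          then show "j \<in> prod_encode ` ({..<M} \<times> {..<M})" using \<open>j \<in> {..<M}\<close> ab by auto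
        qed
        then have "(\<Sum>j<M. q j) \<le> (\<Sum>n<M. min 1 (real M * t n))"
          unfolding q_sum [of M "\<lambda>_. M", symmetric] using q by (intro sum_mono2) auto
        also have "\<dots> \<le> (\<Sum>n<M. if n < n0 then 1 else 0)"
          by (rule sum_mono) (use z in \<open>auto simp: not_less\<close>)
        also have "\<dots> \<le> real n0"
        proof -
          have "(\<Sum>n<M. if n < n0 then 1 else 0 :: real) = real (card ({..<M} \<inter> {n. n < n0}))"
            by (simp add: sum.If_cases)
          also have "\<dots> \<le> real (card {..<n0})"
            by (intro of_nat_mono card_mono) auto
          finally show ?thesis by simp
        qed
        finally have "(\<Sum>j<M. q j) \<le> real n0" .
        moreover have "(\<Sum>j<M. (1 / 2) ^ j) = 2 - 2 * (1 / 2 :: real) ^ M"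
          by (induction M) auto
        then have "(\<Sum>j<M. (1 / 2) ^ j) \<le> (2::real)" by simp
        ultimately show ?thesis
          by (simp add: p sum.distrib sum_divide_distrib [symmetric])
      qed
      obtain M where "(real n0 + 2) / 4 + 1 \<le> (\<Sum>j<M. p j)" using H by blast
      with bound [of M] show False by linarith
    qed
  qed
qed

lemma gdelta_bernoulli_reduction:
  assumes "metrizable_space Y" "gdelta_in Y B"
  obtains r where "\<And>y. bernoulli (r y)" "\<And>j. continuous_map Y euclideanreal (\<lambda>y. r y j)"
    "\<And>y. y \<in> topspace Y \<Longrightarrow> (\<lambda>M. \<Prod>j<M. r y j) \<longlonglongrightarrow> 0 \<longleftrightarrow> y \<in> B"
proof -
  obtain U where U: "\<And>n. openin Y (U n)" "\<And>n. U (Suc n) \<subseteq> U n" "\<Inter>(range U) = B"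
    using assms(2) unfolding gdelta_in_descending by blast
  have "\<exists>h. continuous_map Y euclideanreal h \<and> (\<forall>y. 0 \<le> h y) \<and> (\<forall>y\<in>topspace Y. 0 < h y \<longleftrightarrow> y \<in> U n)" for n
    by (rule open_support_function [OF assms(1) U(1) [of n]]) blast
  then obtain h where h: "\<And>n. continuous_map Y euclideanreal (h n)" "\<And>n y. 0 \<le> h n y"
    "\<And>n y. y \<in> topspace Y \<Longrightarrow> 0 < h n y \<longleftrightarrow> y \<in> U n"
    by metis
  \<comment> \<open>The bracket is at most 2, so the quarter gives \<open>p y j \<le> 1 / 2\<close>
    and \<open>exp (- p y j) \<ge> 1 - p y j \<ge> 1 / 2\<close>. The geometric term keeps
    \<open>p y j\<close> positive, hence the parameter below 1.\<close>
  define p where "p y j = (ramp (snd (prod_decode j)) (h (fst (prod_decode j)) y) + (1 / 2) ^ j) / 4" for y j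
  have p: "0 < p y j" "p y j \<le> 1 / 2" for y j
  proof -
    have "(0::real) < (1 / 2) ^ j" "(1 / 2) ^ j \<le> (1::real)" by (auto intro: power_le_one)
    then show "0 < p y j" "p y j \<le> 1 / 2"
      using ramp_bounds [OF h(2) [of "fst (prod_decode j)" y], of "snd (prod_decode j)"]
      by (auto simp: p_def simp del: power_divide intro: add_nonneg_pos)
  qed
  define r where "r y j = exp (- p y j)" for y j
  have "bernoulli (r y)" for y
  proof
    show "1 / 2 \<le> r y j" for j
      using exp_ge_add_one_self [of "- p y j"] p [of y j] by (simp add: r_def)
    show "r y j < 1" for j using p by (simp add: r_def)
  qed
  moreover have "continuous_map Y euclideanreal (\<lambda>y. r y j)" for j
  proof -
    have "continuous_map Y euclideanreal (\<lambda>y. p y j)"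
      unfolding p_def ramp_def divide_inverse
      by (intro continuous_intros continuous_map_real_mult_right continuous_map_real_mult_left h(1)) auto
    moreover have "continuous_map euclideanreal euclideanreal (\<lambda>t::real. exp (- t))"
      by (simp add: continuous_intros)
    ultimately have "continuous_map Y euclideanreal ((\<lambda>t. exp (- t)) \<circ> (\<lambda>y. p y j))"
      by (rule continuous_map_compose)
    then show ?thesis by (simp add: r_def o_def)
  qed
  moreover have "(\<lambda>M. \<Prod>j<M. r y j) \<longlonglongrightarrow> 0 \<longleftrightarrow> y \<in> B" if y: "y \<in> topspace Y" for y
  proof -
    have "h n y = 0" if "m \<le> n" "h m y = 0" for m n
    proof -
      have "U n \<subseteq> U m" using U(2) \<open>m \<le> n\<close> by (rule lift_Suc_antimono_le)
      moreover have "y \<notin> U m"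
        using h(3) [OF y, of m] \<open>h m y = 0\<close> by simp
      ultimately have "\<not> 0 < h n y"
        using h(3) [OF y, of n] by blast
      then show ?thesis using h(2) [of n y] by simp
    qed
    then have "(\<forall>C. \<exists>M. C \<le> (\<Sum>j<M. p y j)) \<longleftrightarrow> (\<forall>n. 0 < h n y)"
      unfolding p_def by (rule unbounded_ramp_sums_iff [OF h(2)])
    moreover have "(\<forall>n. 0 < h n y) \<longleftrightarrow> y \<in> B"
      using h(3) [OF y] U(3) by auto
    ultimately show ?thesis
      unfolding r_def using prod_exp_minus_tendsto_0_iff [of "p y"] p by (simp add: less_imp_le)
  qed
  ultimately show ?thesis using that by blast
qed

theorem theorem5p8:
  assumes "I \<in> {Pset, Pinf, Bset}"
  shows "Gdelta_complete TYPE('b) (subtopology RV I) {\<mu> \<in> I. Daugavet \<mu>}"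
proof -
  \<comment> \<open>One reduction serves all three classes: its values lie in the smallest one, and
    membership depends only on the Daugavet property.\<close>
  have I: "Bset \<subseteq> I" "I \<subseteq> Pset"
    using assms by (auto simp: Pinf_def Bset_def)
  have "\<exists>f. continuous_map Y (subtopology RV I) f \<and> B = {y \<in> topspace Y. f y \<in> {\<mu> \<in> I. Daugavet \<mu>}}"
    if Y: "Polish_top Y" and B: "gdelta_in Y B" for Y :: "'b topology" and B
  proof -
    have "metrizable_space Y"
      using Y by (simp add: Polish_top_def completely_metrizable_imp_metrizable_space)
    then obtain r where r: "\<And>y. bernoulli (r y)" "\<And>j. continuous_map Y euclideanreal (\<lambda>y. r y j)"
      "\<And>y. y \<in> topspace Y \<Longrightarrow> (\<lambda>M. \<Prod>j<M. r y j) \<longlonglongrightarrow> 0 \<longleftrightarrow> y \<in> B"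
      using gdelta_bernoulli_reduction B by blast
    have in_I: "bcode (r y) \<in> I" for y
      using bernoulli.bcode_Bset [OF r(1)] I by blast
    have "continuous_map Y RV (\<lambda>y. bcode (r y))"
      unfolding RV_def continuous_map_componentwise
      using continuous_map_bnorm [OF rvec_c00 r(2)] by (auto simp: bcode_def)
    then have "continuous_map Y (subtopology RV I) (\<lambda>y. bcode (r y))"
      using in_I by (auto simp: continuous_map_in_subtopology)
    moreover have "B = {y \<in> topspace Y. bcode (r y) \<in> {\<mu> \<in> I. Daugavet \<mu>}}"
      using gdelta_in_subset [OF B] r(3) in_I bernoulli.Daugavet_bcode_iff [OF r(1)] by auto
    ultimately show ?thesis by blast
  qed
  then show ?thesis
    unfolding Gdelta_complete_def using gdelta_in_Daugavet [OF I(2)] by blast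
qed

end
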